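(* For every $k\in\mathbb{N}\setminus\{0\}$ and every open set $\Omega\subseteq\mathbb{R}^2$ that is multiply connected of order $k$, we have \[ \lambda(\Omega)\ \le\ \left(\frac{j_{0,1}}{\Theta_{1,1}}\right)^2\,k\,\big(h(\Omega)\big)^2, \] where $j_{0,1}$ is the first (positive) zero of the Bessel function of the first kind $J_0$ and $\Theta_{1,1}>0$ is the explicit universal constant given in the context.
   Context: For an open set $\Omega\subseteq\mathbb{R}^2$, \[ \lambda(\Omega)=\inf_{u\in C^\infty_0(\Omega)\setminus\{0\}}\frac{\|\nabla u\|_{L^2(\Omega)}^2}{\|u\|_{L^2(\Omega)}^2},\qquad h(\Omega)=\inf\left\{\frac{\mathcal{H}^{1}(\partial E)}{|E|} : E\Subset\Omega \text{ has a smooth boundary}\right\}, \] where in the Cheeger constant $h(\Omega)$ the set $E$ ranges over nonempty open sets compactly contained in $\Omega$ with smooth boundary, $\mathcal{H}^1$ is the one-dimensional Hausdorff measure and $|\cdot|$ is Lebesgue measure. Let $(\mathbb{R}^2)^*$ be the one-point compactification of $\mathbb{R}^2$. An open connected set $\Omega\subseteq\mathbb{R}^2$ is multiply connected of order $k$ if its complement in $(\mathbb{R}^2)^*$ has exactly $k$ connected components. The constant is \[ \Theta_{1,1}=\frac{\mathscr{C}}{2\cdot 10^{2}},\qquad \mathscr{C}=\frac{1}{4\cdot 6^{7}\cdot 2^{7}}\left(\frac12\right)^{10}\left[\pi+\frac{4\pi}{1-\frac{\sqrt2}{2}}\,\frac{1}{\mu_{1,1}(B_1)}\right]^{-1}, \]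 where $B_1\subseteq\mathbb{R}^2$ is the open unit disk centered at the origin and \[ \mu_{1,1}(B_1)=\inf\left\{\frac{\|\nabla u\|_{L^1(B_1)}}{\min_{t\in\mathbb{R}}\|u-t\|_{L^1(B_1)}} : u\in\mathrm{Lip}(\overline{B_1})\text{ not constant}\right\}>0 . \] *)

theory Defs
  imports "HOL-Analysis.Analysis"
begin

section \<open>Smooth functions, gradients and norms\<close>

text \<open>\<open>frechet_derivative u (at x) b\<close> is the partial derivative of \<open>u\<close> at \<open>x\<close> in direction \<open>b\<close>.\<close>

primrec Ck :: "nat \<Rightarrow> ('a::euclidean_space \<Rightarrow> 'b::real_normed_vector) \<Rightarrow> bool" where
  "Ck 0 u \<longleftrightarrow> continuous_on UNIV u"
| "Ck (Suc k) u \<longleftrightarrow> (\<forall>x. u differentiable (at x)) \<and>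
     (\<forall>b\<in>Basis. Ck k (\<lambda>x. frechet_derivative u (at x) b))"

definition smooth :: "('a::euclidean_space \<Rightarrow> 'b::real_normed_vector) \<Rightarrow> bool" where
  "smooth u \<longleftrightarrow> (\<forall>k. Ck k u)"

text \<open>Functions on \<open>\<Omega>\<close> with compact support are identified with their extensions by zero.\<close>

definition test_functions :: "'a::euclidean_space set \<Rightarrow> ('a \<Rightarrow> real) set" where
  "test_functions \<Omega> =
     {u. smooth u \<and> compact (closure {x. u x \<noteq> 0}) \<and> closure {x. u x \<noteq> 0} \<subseteq> \<Omega>}"

text \<open>The classical gradient. For Lipschitz functions it exists almost everywhere (Rademacher) and
  agrees with the weak gradient; at other points its value is unspecified, which is irrelevant
  for integrals.\<close>

definition grad :: "('a::euclidean_space \<Rightarrow> real) \<Rightarrow> 'a \<Rightarrow> 'a" where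
  "grad u x = (\<Sum>b\<in>Basis. frechet_derivative u (at x) b *\<^sub>R b)"

definition Lp_norm :: "real \<Rightarrow> 'a::euclidean_space set \<Rightarrow> ('a \<Rightarrow> 'b::real_normed_vector) \<Rightarrow> real" where
  "Lp_norm p A u = (LINT x:A|lebesgue. norm (u x) powr p) powr (1 / p)"


section \<open>The fundamental frequency\<close>

text \<open>Both \<open>freq\<close> and the Cheeger constant below take values in \<open>[0,\<infinity>]\<close>, so that the infimum of
  the empty set (for \<open>\<Omega> = {}\<close>) is \<open>\<infinity>\<close>.\<close>

definition freq :: "'a::euclidean_space set \<Rightarrow> ennreal" where
  "freq \<Omega> = (INF u \<in> test_functions \<Omega> - {\<lambda>x. 0}.
     ennreal ((Lp_norm 2 \<Omega> (grad u))\<^sup>2 / (Lp_norm 2 \<Omega> u)\<^sup>2))"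


section \<open>The Cheeger constant\<close>

text \<open>One-dimensional Hausdorff measure; the normalising constant is 1 in dimension one.
  Covering sets are required to be bounded because \<^const>\<open>diameter\<close> is only meaningful for those.\<close>

definition H1_delta :: "real \<Rightarrow> 'a::metric_space set \<Rightarrow> ennreal" where
  "H1_delta \<delta> A =
     (INF U \<in> {U :: nat \<Rightarrow> 'a set. A \<subseteq> (\<Union>i. U i) \<and> (\<forall>i. bounded (U i) \<and> diameter (U i) \<le> \<delta>)}.
        \<Sum>i. ennreal (diameter (U i)))"

definition H1 :: "'a::metric_space set \<Rightarrow> ennreal" where
  "H1 A = (SUP \<delta>\<in>{0<..}. H1_delta \<delta> A)"

text \<open>Near each boundary point, in suitable orthonormal coordinates, \<open>E\<close> is the strict epigraph of a
  smooth function of one variable.\<close>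

definition smooth_boundary :: "(real^2) set \<Rightarrow> bool" where
  "smooth_boundary E \<longleftrightarrow> (\<forall>x\<in>frontier E. \<exists>r>0. \<exists>T :: real^2 \<Rightarrow> real^2. \<exists>\<gamma> :: real \<Rightarrow> real.
     orthogonal_transformation T \<and> smooth \<gamma> \<and>
     E \<inter> ball x r = {y \<in> ball x r. \<gamma> (T y $ 1) < T y $ 2})"

definition cheeger :: "(real^2) set \<Rightarrow> ennreal" where
  "cheeger \<Omega> =
     (INF E \<in> {E. E \<noteq> {} \<and> open E \<and> compact (closure E) \<and> closure E \<subseteq> \<Omega> \<and> smooth_boundary E}.
        H1 (frontier E) / emeasure lebesgue E)"


section \<open>Multiply connected sets\<close>

text \<open>In \<^const>\<open>Alexandroff_compactification\<close> the point at infinity is \<open>None\<close>.\<close>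

definition multiply_connected :: "nat \<Rightarrow> 'a::euclidean_space set \<Rightarrow> bool" where
  "multiply_connected k \<Omega> \<longleftrightarrow> open \<Omega> \<and> connected \<Omega> \<and>
     (let X = Alexandroff_compactification (euclidean :: 'a topology);
          C = connected_components_of (subtopology X (topspace X - Some ` \<Omega>))
      in finite C \<and> card C = k)"


section \<open>The constants\<close>

definition bessel_J :: "nat \<Rightarrow> real \<Rightarrow> real" where
  "bessel_J n x = (\<Sum>m. (- 1) ^ m / (fact m * fact (m + n)) * (x / 2) ^ (2 * m + n))"

definition j01 :: real where
  "j01 = (LEAST x. 0 < x \<and> bessel_J 0 x = 0)"

definition mu11_disk :: real where
  "mu11_disk = (let B = ball (0 :: real^2) 1 in
     INF u \<in> {u :: real^2 \<Rightarrow> real. (\<exists>L. L-lipschitz_on (closure B) u) \<and> \<not> u constant_on closure B}.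
       Lp_norm 1 B (grad u) / (INF t. Lp_norm 1 B (\<lambda>x. u x - t)))"

definition const_C :: real where
  "const_C = 1 / (4 * 6 ^ 7 * 2 ^ 7) * (1 / 2) ^ 10 *
     inverse (pi + 4 * pi / (1 - sqrt 2 / 2) * (1 / mu11_disk))"

definition Theta11 :: real where
  "Theta11 = const_C / (2 * 10\<^sup>2)"

lemma Lp_norm_nonneg: "0 \<le> Lp_norm p A u"
  by (simp add: Lp_norm_def)

lemma mu11_disk_nonneg: "0 \<le> mu11_disk"
proof -
  let ?B = "ball (0 :: real^2) 1"
  let ?u = "\<lambda>x :: real^2. x $ 1"
  have "\<exists>L. L-lipschitz_on (closure ?B) ?u"
    by (rule exI[of _ 1]) (simp add: lipschitz_on_def dist_vec_nth_le)
  moreover have "\<not> ?u constant_on closure ?B"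
  proof
    assume "?u constant_on closure ?B"
    then obtain c where c: "\<And>x :: real^2. x \<in> closure ?B \<Longrightarrow> x $ 1 = c"
      by (auto simp: constant_on_def)
    have "(0 :: real^2) \<in> closure ?B" "(axis 1 1 :: real^2) \<in> closure ?B"
      by (auto simp: norm_axis_1)
    from c[OF this(1)] c[OF this(2)] show False
      by (simp add: axis_def)
  qed
  ultimately have "?u \<in> {u. (\<exists>L. L-lipschitz_on (closure ?B) u) \<and> \<not> u constant_on closure ?B}"
    by blast
  then show ?thesis
    unfolding mu11_disk_def Let_def
    by (intro cINF_greatest divide_nonneg_nonneg Lp_norm_nonneg) (auto intro: Lp_norm_nonneg)
qed

lemma Theta11_pos: "0 < Theta11"
proof -
  have "sqrt 2 < 2"
    by (simp add: real_less_lsqrt)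
  then have "0 \<le> 4 * pi / (1 - sqrt 2 / 2) * (1 / mu11_disk)"
    using mu11_disk_nonneg by simp
  then have "0 < pi + 4 * pi / (1 - sqrt 2 / 2) * (1 / mu11_disk)"
    using pi_gt_zero by linarith
  then show ?thesis
    by (simp add: Theta11_def const_C_def)
qed

end

theory Submission
  imports Defs
begin

text \<open>If \<open>\<Omega>\<close> contains a disk of radius \<open>r\<close>, a bump function shows that the frequency of \<open>\<Omega>\<close> is at most a
  constant over \<open>r\<^sup>2\<close>. So it suffices to find, for every admissible \<open>E\<close> with area \<open>m\<close> and perimeter \<open>P\<close>, a disk
  in \<open>\<Omega>\<close> whose radius is comparable to \<open>m / (sqrt k * P)\<close>.

  Suppose that every cell of the square grid of mesh \<open>s\<close> contains a point of the complement. If the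
  complement component of that point leaves the square of half-side \<open>s\<close> around it, it crosses all
  concentric smaller squares, and projecting to the coordinate axes shows that the area of \<open>E\<close> in the
  cell is at most a constant times \<open>s\<close> times the length of the frontier near the cell. The other cells
  belong to small components, hence there are at most \<open>9 * k\<close> of them, and \<open>E\<close> has area at most
  \<open>9 * k * s\<^sup>2\<close> in their union \<open>D\<close>. As \<open>m \<le> P\<^sup>2\<close> (project again), the area of \<open>E \<inter> D\<close> is at most
  \<open>3 * sqrt k * s * P\<close>. Altogether \<open>m\<close> is at most a constant times \<open>sqrt k * s * P\<close>. The constant in the
  theorem is so large that all of these estimates can be crude.\<close>

section \<open>A bump function and the frequency\<close>

lemma Ck_SucI:
  assumes "\<And>x. (u has_derivative u' x) (at x)" "\<And>b. b \<in> Basis \<Longrightarrow> Ck k (\<lambda>x. u' x b)"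
  shows "Ck (Suc k) u"
proof -
  \<comment> \<open>Uniqueness of the derivative replaces the choice operator in \<open>Ck\<close>
    by an explicit family \<open>u'\<close>.\<close>
  have "frechet_derivative u (at x) = u' x" for x
    using frechet_derivative_at[OF assms(1)] by simp
  then show ?thesis
    using assms by (auto simp: differentiable_def)
qed

lemma Ck_Suc_imp_Ck: "Ck (Suc k) u \<Longrightarrow> Ck k u"
proof (induction k arbitrary: u)
  case 0
  then show ?case
    by (auto intro!: continuous_at_imp_continuous_on differentiable_imp_continuous_within)
next
  case (Suc k)
  then show ?case
    by (metis Ck.simps(2))
qed

lemma Ck_const: "Ck k (\<lambda>x. c)"
proof (induction k arbitrary: c)
  case (Suc k)
  show ?case
    by (rule Ck_SucI[where u' = "\<lambda>x y. 0"]) (auto intro: Suc)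
qed simp

lemma Ck_add: "Ck k u \<Longrightarrow> Ck k v \<Longrightarrow> Ck k (\<lambda>x. u x + v x)"
proof (induction k arbitrary: u v)
  case 0
  then show ?case by (auto intro: continuous_on_add)
next
  case (Suc k)
  show ?case
    using Suc
    by (intro Ck_SucI[where u' = "\<lambda>x h. frechet_derivative u (at x) h + frechet_derivative v (at x) h"])
      (auto intro!: has_derivative_add simp: frechet_derivative_works[symmetric])
qed

lemma Ck_mult:
  fixes u v :: "'a::euclidean_space \<Rightarrow> real"
  shows "Ck k u \<Longrightarrow> Ck k v \<Longrightarrow> Ck k (\<lambda>x. u x * v x)"
proof (induction k arbitrary: u v)
  case 0
  then show ?case by (auto intro: continuous_on_mult)
next
  case (Suc k)
  have k: "Ck k u" "Ck k v"
    using Suc.prems by (auto intro: Ck_Suc_imp_Ck simp del: Ck.simps)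
  show ?case
    using Suc k
    by (intro Ck_SucI[where u' = "\<lambda>x h. u x * frechet_derivative v (at x) h + frechet_derivative u (at x) h * v x"])
      (auto intro!: has_derivative_mult Ck_add simp: frechet_derivative_works[symmetric])
qed

lemma Ck_inner_left: "Ck k (\<lambda>x. (x - a) \<bullet> b)"
  by (cases k)
    (auto intro!: continuous_intros Ck_SucI[where u' = "\<lambda>x h. h \<bullet> b"] Ck_const derivative_eq_intros
       simp del: Ck.simps(2))

text \<open>Allowing the factor \<open>1 / t ^ n\<close> makes the family closed under differentiation, up to linear
  combinations.\<close>

definition flat :: "nat \<Rightarrow> real \<Rightarrow> real" where
  "flat n t = (if 0 < t then exp (- 1 / t) / t ^ n else 0)"

lemma flat_nonneg: "0 \<le> flat n t"
  by (simp add: flat_def)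

lemma power_div_fact_le_exp:
  fixes x :: real
  assumes "0 \<le> x"
  shows "x ^ n / fact n \<le> exp x"
proof -
  have s: "(\<lambda>n. x ^ n / fact n) sums exp x"
    using exp_converges[of x] by (simp add: divide_inverse mult.commute)
  have "(\<Sum>i\<in>{n}. x ^ i / fact i) \<le> (\<Sum>i. x ^ i / fact i)"
    using assms by (intro sum_le_suminf sums_summable[OF s]) auto
  with s show ?thesis
    by (simp add: sums_iff)
qed

text \<open>A single term of the exponential series at \<open>1 / t\<close> gives exp (-1/t) \<le>
  (n+m)! t^(n+m), and dividing by t^n leaves t^m. The choice m = 2 yields differentiability at 0,
  and m = 0 a uniform bound.\<close>

lemma flat_le: "flat n t \<le> fact (n + m) * \<bar>t\<bar> ^ m"
proof (cases "0 < t")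
  case True
  have "1 \<le> fact (n + m) * t ^ (n + m) * exp (1 / t)"
    using power_div_fact_le_exp[of "1 / t" "n + m"] True by (simp add: field_simps)
  then have "exp (- 1 / t) \<le> fact (n + m) * t ^ (n + m)"
    by (simp add: exp_minus field_simps)
  then show ?thesis
    using True by (simp add: flat_def field_simps power_add)
next
  case False
  then show ?thesis by (simp add: flat_def)
qed

lemma flat_has_real_derivative:
  "(flat n has_real_derivative (flat (n + 2) t - n * flat (n + 1) t)) (at t)"
proof -
  consider "t < 0" | "t = 0" | "0 < t" by linarith
  then show ?thesis
  proof cases
    case 1
    have "(flat n has_real_derivative 0) (at t)"
      by (rule has_field_derivative_transform_within_open[where S = "{..<0}" and f = "\<lambda>_. 0"])
        (use 1 in \<open>auto simp: flat_def\<close>)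
    with 1 show ?thesis
      by (simp add: flat_def)
  next
    case 2
    \<comment> \<open>By \<open>flat_le\<close> with m = 2, one factor of
      \<open>\<bar>h\<bar>\<close> survives in the difference quotient.\<close>
    have "((\<lambda>h. flat n h / h) \<longlongrightarrow> 0) (at 0)"
    proof (rule Lim_null_comparison)
      have "norm (flat n h / h) \<le> fact (n + 2) * \<bar>h\<bar>" if "h \<noteq> 0" for h
        using flat_le[of n h 2] that flat_nonneg[of n h]
        by (simp add: divide_simps power2_eq_square mult.assoc abs_mult)
      then show "\<forall>\<^sub>F h in at 0. norm (flat n h / h) \<le> fact (n + 2) * \<bar>h\<bar>"
        by (auto simp: eventually_at_filter)
      show "((\<lambda>h. fact (n + 2) * \<bar>h\<bar>) \<longlongrightarrow> 0) (at (0::real))"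
        by (auto intro!: tendsto_eq_intros)
    qed
    with 2 show ?thesis
      by (simp add: DERIV_def flat_def)
  next
    case 3
    have "((\<lambda>t. exp (- 1 / t) / t ^ n) has_real_derivative
        (exp (- 1 / t) * (1 / t\<^sup>2) * t ^ n - exp (- 1 / t) * (n * t ^ (n - 1))) / (t ^ n * t ^ n)) (at t)"
      using 3 by (auto intro!: derivative_eq_intros simp: power2_eq_square)
    also have "(exp (- 1 / t) * (1 / t\<^sup>2) * t ^ n - exp (- 1 / t) * (n * t ^ (n - 1))) / (t ^ n * t ^ n)
        = flat (n + 2) t - n * flat (n + 1) t"
      using 3 by (cases n) (auto simp: flat_def field_simps power2_eq_square)
    finally show ?thesis
      by (rule has_field_derivative_transform_within_open[where S = "{0<..}"])
        (use 3 in \<open>auto simp: flat_def\<close>)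
  qed
qed

lemma flat_compose_has_derivative:
  assumes "(q has_derivative q') (at x)"
  shows "((\<lambda>x. flat n (q x)) has_derivative
    (\<lambda>h. (flat (n + 2) (q x) - n * flat (n + 1) (q x)) * q' h)) (at x)"
  using has_derivative_compose[OF assms flat_has_real_derivative[unfolded has_field_derivative_def]]
  by simp

text \<open>Differentiation raises the index of \<open>flat\<close> by one or two, so the induction
  on \<open>k\<close> has to run for all \<open>n\<close> at once.\<close>

lemma Ck_flat_compose:
  assumes q: "\<And>x. (q has_derivative q' x) (at x)"
    and q': "\<And>k b. b \<in> Basis \<Longrightarrow> Ck k (\<lambda>x. q' x b)"
  shows "Ck k (\<lambda>x. flat n (q x))"
proof (induction k arbitrary: n)
  case 0
  have "isCont (\<lambda>x. flat n (q x)) x" for x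
    using flat_compose_has_derivative[OF q] by (rule has_derivative_continuous)
  then show ?case
    by (simp add: continuous_at_imp_continuous_on)
next
  case (Suc k)
  have "Ck k (\<lambda>x. (flat (n + 2) (q x) + (- real n) * flat (n + 1) (q x)) * q' x b)" if "b \<in> Basis" for b
    using that by (intro Ck_mult Ck_add Ck_const Suc q')
  then show ?case
    by (intro Ck_SucI[OF flat_compose_has_derivative[OF q]]) simp
qed

text \<open>The classical mollifier exp (-1 / (1 - |x - a|^2 / r^2)); the squared norm, written as
  an inner product, keeps its argument polynomial.\<close>

definition bump :: "'a::euclidean_space \<Rightarrow> real \<Rightarrow> 'a \<Rightarrow> real" where
  "bump a r x = flat 0 (1 - ((x - a) \<bullet> (x - a)) / r\<^sup>2)"

lemma bump_arg_has_derivative: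
  "((\<lambda>x. 1 - ((x - a) \<bullet> (x - a)) / r\<^sup>2) has_derivative (\<lambda>h. (x - a) \<bullet> h * (- 2 / r\<^sup>2))) (at x)"
proof -
  have "((\<lambda>x. 1 - c * ((x - a) \<bullet> (x - a))) has_derivative (\<lambda>h. (x - a) \<bullet> h * (- 2 * c))) (at x)" for c
    by (auto intro!: derivative_eq_intros simp: inner_commute)
  from this[of "1 / r\<^sup>2"] show ?thesis
    by simp
qed

lemma smooth_bump: "smooth (bump a r)"
  unfolding smooth_def bump_def[abs_def]
  by (auto intro!: Ck_flat_compose[OF bump_arg_has_derivative] Ck_mult Ck_inner_left Ck_const)

lemma bump_arg_pos_iff:
  assumes "0 < r"
  shows "0 < 1 - ((x - a) \<bullet> (x - a)) / r\<^sup>2 \<longleftrightarrow> x \<in> ball a r"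
proof -
  have "(norm (x - a))\<^sup>2 < r\<^sup>2 \<longleftrightarrow> norm (x - a) < r"
    using abs_le_square_iff[of r "norm (x - a)"] assms by (simp add: not_le[symmetric])
  then show ?thesis
    using assms by (simp add: dot_square_norm dist_norm norm_minus_commute)
qed

lemma bump_eq_0: "0 < r \<Longrightarrow> x \<notin> ball a r \<Longrightarrow> bump a r x = 0"
  using bump_arg_pos_iff[of r x a] by (simp add: bump_def flat_def)

lemma bump_le_1: "bump a r x \<le> 1"
  using flat_le[of 0 _ 0] by (simp add: bump_def)

lemma bump_nonneg: "0 \<le> bump a r x"
  by (simp add: bump_def flat_nonneg)

text \<open>On the half ball the argument of \<open>flat\<close> is at least 1/2, so the value is at
  least exp (-2), and e \<le> 3.\<close>

lemma bump_ge:
  assumes "0 < r" "x \<in> ball a (r / 2)"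
  shows "1 / 9 \<le> bump a r x"
proof -
  define t where "t = 1 - ((x - a) \<bullet> (x - a)) / r\<^sup>2"
  have "norm (x - a) \<le> r / 2"
    using assms by (simp add: dist_norm norm_minus_commute)
  then have "norm (x - a) ^ 2 \<le> (r / 2)\<^sup>2"
    by (intro power_mono) auto
  then have "4 * norm (x - a) ^ 2 \<le> r\<^sup>2"
    by (simp add: power_divide)
  moreover have "0 \<le> norm (x - a) ^ 2"
    by simp
  ultimately have "2 * norm (x - a) ^ 2 \<le> r\<^sup>2"
    by linarith
  then have t: "1 / 2 \<le> t"
    using assms(1) by (simp add: t_def dot_square_norm field_simps)
  have "1 / 9 \<le> exp (- 2 :: real)"
  proof -
    have "exp (1::real) ^ 2 \<le> 3 ^ 2"
      using exp_le by (intro power_mono) auto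
    then show ?thesis
      by (simp add: exp_minus exp_double[symmetric] exp_of_nat_mult[symmetric] field_simps)
  qed
  also have "\<dots> \<le> exp (- 1 / t)"
    using t by (simp add: field_simps)
  also have "\<dots> = bump a r x"
    using t by (simp add: bump_def t_def[symmetric] flat_def)
  finally show ?thesis .
qed

text \<open>The derivative of \<open>flat 0\<close> is \<open>flat 2\<close>, which is at most 2! =
  2; the inner derivative contributes 2 |x - a| / r^2, which is at most 2 / r on the ball.\<close>

lemma norm_grad_bump_le:
  assumes "0 < r"
  shows "norm (grad (bump a r) x) \<le> 4 / r * indicator (ball a r) x"
proof -
  define c where "c = flat 2 (1 - ((x - a) \<bullet> (x - a)) / r\<^sup>2)"
  have "frechet_derivative (bump a r) (at x) = (\<lambda>h. c * ((x - a) \<bullet> h * (- 2 / r\<^sup>2)))"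
    using frechet_derivative_at[OF flat_compose_has_derivative[OF bump_arg_has_derivative[of a r x], of 0]]
    by (simp add: bump_def[abs_def] c_def numeral_2_eq_2)
  then have "grad (bump a r) x = (c * (- 2 / r\<^sup>2)) *\<^sub>R (\<Sum>b\<in>Basis. ((x - a) \<bullet> b) *\<^sub>R b)"
    unfolding grad_def scaleR_sum_right by (intro sum.cong) auto
  then have g: "norm (grad (bump a r) x) = c * (2 / r\<^sup>2) * norm (x - a)"
    by (simp add: euclidean_representation c_def flat_nonneg)
  show ?thesis
  proof (cases "x \<in> ball a r")
    case True
    have "c \<le> 2"
      using flat_le[of 2 _ 0] by (simp add: c_def numeral_2_eq_2)
    moreover have "norm (x - a) \<le> r"
      using True by (simp add: dist_norm norm_minus_commute)
    ultimately have "c * (2 / r\<^sup>2) * norm (x - a) \<le> 2 * (2 / r\<^sup>2) * r"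
      by (intro mult_mono) (auto simp: c_def flat_nonneg)
    with g True assms show ?thesis
      by (simp add: power2_eq_square)
  next
    case False
    then have "c = 0"
      using bump_arg_pos_iff[OF assms, of x a] by (simp add: c_def flat_def)
    with g show ?thesis
      using assms by simp
  qed
qed

section \<open>The bump function as a competitor for the frequency\<close>

lemma Lp_norm_2_squared: "(Lp_norm 2 A u)\<^sup>2 = (LINT x:A|lebesgue. (norm (u x))\<^sup>2)"
proof -
  have "0 \<le> (LINT x:A|lebesgue. (norm (u x))\<^sup>2)"
    unfolding set_lebesgue_integral_def by (rule Bochner_Integration.integral_nonneg) (auto simp: indicator_def)
  then show ?thesis
    by (simp add: Lp_norm_def powr_numeral powr_half_sqrt)
qed

text \<open>The numerator is at most 16 / r^2 times the volume of the ball, the denominator at least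
  1/81 of the volume of the half ball; 1296 = 16 * 81, and the power of 2 is the ratio of the
  volumes.\<close>

lemma freq_le_if_cball_subset:
  fixes a :: "'a::euclidean_space"
  assumes r: "0 < r" and sub: "cball a r \<subseteq> \<Omega>" and op: "open \<Omega>"
  shows "freq \<Omega> \<le> ennreal (1296 * 2 ^ DIM('a) / r\<^sup>2)"
proof -
  let ?u = "bump a r"
  define V where "V = measure lebesgue (ball a (r / 2))"
  have V: "0 < V" "measure lebesgue (ball a r) = 2 ^ DIM('a) * V"
    using r by (simp_all add: V_def content_ball power_divide)
  have supp: "{x. ?u x \<noteq> 0} \<subseteq> ball a r"
    using bump_eq_0[OF r] by blast
  have cl: "closure {x. ?u x \<noteq> 0} \<subseteq> cball a r"
    using closure_mono[OF supp] r by simp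
  have "compact (closure {x. ?u x \<noteq> 0})"
    using cl by (auto simp: compact_eq_bounded_closed intro: bounded_subset)
  then have tf: "?u \<in> test_functions \<Omega>"
    using cl sub smooth_bump[of a r] by (auto simp: test_functions_def)
  have "?u a \<noteq> 0"
    using bump_ge[OF r, of a a] r by auto
  then have nz: "?u \<noteq> (\<lambda>x. 0)"
    by metis
  have G: "(Lp_norm 2 \<Omega> (grad ?u))\<^sup>2 \<le> 16 / r\<^sup>2 * (2 ^ DIM('a) * V)"
  proof -
    \<comment> \<open>Integrability is checked for the nonnegative majorant only: a non-integrable
      function has integral 0 by default.\<close>
    have "(LINT x:\<Omega>|lebesgue. (norm (grad ?u x))\<^sup>2) \<le> (LINT x|lebesgue. 16 / r\<^sup>2 * indicator (ball a r) x)"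
      unfolding set_lebesgue_integral_def
    proof (rule integral_mono')
      show "integrable lebesgue (\<lambda>x. 16 / r\<^sup>2 * indicator (ball a r) x :: real)"
        by (intro integrable_mult_right) (simp add: lmeasurable_iff_integrable[symmetric])
      fix x
      have "(norm (grad ?u x))\<^sup>2 \<le> (4 / r * indicator (ball a r) x)\<^sup>2"
        using norm_grad_bump_le[OF r, of a x] by (intro power_mono) auto
      then show "indicator \<Omega> x *\<^sub>R (norm (grad ?u x))\<^sup>2 \<le> 16 / r\<^sup>2 * indicator (ball a r) x"
        by (auto simp: indicator_def power_divide split: if_splits)
    qed (auto simp: indicator_def)
    then show ?thesis
      using V by (simp add: Lp_norm_2_squared)
  qed
  have U: "V / 81 \<le> (Lp_norm 2 \<Omega> ?u)\<^sup>2"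
  proof -
    have "?u \<in> borel_measurable borel"
      using smooth_bump[of a r] by (intro borel_measurable_continuous_onI) (metis smooth_def Ck.simps(1))
    then have m[measurable]: "?u \<in> borel_measurable lebesgue"
      by (simp add: measurable_completion)
    have [measurable]: "\<Omega> \<in> sets lebesgue"
      using op by simp
    have "(LINT x|lebesgue. 1 / 81 * indicator (ball a (r / 2)) x) \<le> (LINT x:\<Omega>|lebesgue. (norm (?u x))\<^sup>2)"
      unfolding set_lebesgue_integral_def
    proof (rule integral_mono')
      show "integrable lebesgue (\<lambda>x. indicator \<Omega> x *\<^sub>R (norm (?u x))\<^sup>2)"
      proof (rule Bochner_Integration.integrable_bound)
        show "integrable lebesgue (indicator (ball a r) :: 'a \<Rightarrow> real)"
          by (simp add: lmeasurable_iff_integrable[symmetric])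
        have "norm (indicator \<Omega> x *\<^sub>R (norm (?u x))\<^sup>2) \<le> norm (indicator (ball a r) x :: real)" for x
          using bump_eq_0[OF r, of x a] bump_le_1[of a r x] bump_nonneg[of a r x]
          by (cases "x \<in> ball a r"; cases "x \<in> \<Omega>") (auto simp: power_le_one)
        then show "AE x in lebesgue. norm (indicator \<Omega> x *\<^sub>R (norm (?u x))\<^sup>2) \<le> norm (indicator (ball a r) x :: real)"
          by (rule AE_I2)
      qed measurable
      fix x
      show "1 / 81 * indicator (ball a (r / 2)) x \<le> indicator \<Omega> x *\<^sub>R (norm (?u x))\<^sup>2"
      proof (cases "x \<in> ball a (r / 2)")
        case True
        then have "x \<in> \<Omega>"
          using sub r by (auto simp: subset_eq)
        moreover have "(1 / 9)\<^sup>2 \<le> (?u x)\<^sup>2"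
          using bump_ge[OF r True] by (intro power_mono) auto
        ultimately show ?thesis
          using True by (simp add: power_divide)
      qed auto
    qed (auto simp: indicator_def)
    then show ?thesis
      using V by (simp add: Lp_norm_2_squared V_def)
  qed
  have "freq \<Omega> \<le> ennreal ((Lp_norm 2 \<Omega> (grad ?u))\<^sup>2 / (Lp_norm 2 \<Omega> ?u)\<^sup>2)"
    unfolding freq_def using tf nz by (intro INF_lower) auto
  also have "\<dots> \<le> ennreal ((16 / r\<^sup>2 * (2 ^ DIM('a) * V)) / (V / 81))"
    using V r by (intro ennreal_leI frac_le G U) auto
  also have "(16 / r\<^sup>2 * (2 ^ DIM('a) * V)) / (V / 81) = 1296 * 2 ^ DIM('a) / r\<^sup>2"
    using V by simp
  finally show ?thesis .
qed

section \<open>Projections of the frontier\<close>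

text \<open>The indicator of the rectangle is a product over the two basis vectors. Keeping
  \<open>i\<close> and \<open>j\<close> abstract allows slabs in either direction.\<close>

lemma emeasure_lborel_rectangle:
  fixes i j :: 2
  assumes "i \<noteq> j" and [measurable]: "X \<in> sets borel" "Y \<in> sets borel"
  shows "emeasure lborel {x :: real^2. x $ i \<in> X \<and> x $ j \<in> Y} = emeasure lborel X * emeasure lborel Y"
proof -
  define f :: "real^2 \<Rightarrow> real \<Rightarrow> ennreal"
    where "f b = (if b = axis i 1 then indicator X else indicator Y)" for b
  have U: "(UNIV :: 2 set) = {i, j}"
    using assms(1) exhaust_2[of i] exhaust_2[of j] by (auto simp: UNIV_2)
  have B: "(Basis :: (real^2) set) = {axis i 1, axis j 1}"
    unfolding Basis_vec_def using U by auto
  have ne: "axis j 1 \<noteq> (axis i 1 :: real^2)"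
    using assms(1) by (simp add: axis_eq_axis)
  have "(\<integral>\<^sup>+x. (\<Prod>b\<in>Basis. f b (x \<bullet> b)) \<partial>lborel) = (\<Prod>b\<in>Basis. (\<integral>\<^sup>+x. f b x \<partial>lborel))"
    by (intro nn_integral_lborel_prod) (auto simp: f_def)
  also have "(\<lambda>x. \<Prod>b\<in>Basis. f b (x \<bullet> b)) = indicator {x. x $ i \<in> X \<and> x $ j \<in> Y}"
    using ne by (auto simp: B f_def inner_axis fun_eq_iff indicator_def)
  also have "(\<Prod>b\<in>Basis. (\<integral>\<^sup>+x. f b x \<partial>lborel)) = emeasure lborel X * emeasure lborel Y"
    using ne by (simp add: B f_def)
  finally show ?thesis
    by simp
qed

lemma bounded_real_subset_Icc_diameter:
  fixes V :: "real set"
  assumes "bounded V"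
  shows "\<exists>a. V \<subseteq> {a..a + diameter V}"
proof (cases "V = {}")
  case False
  have "x \<le> Inf V + diameter V" if "x \<in> V" for x
  proof -
    have "x - diameter V \<le> y" if "y \<in> V" for y
      using diameter_bounded_bound[OF assms \<open>x \<in> V\<close> that] by (simp add: dist_real_def)
    then have "x - diameter V \<le> Inf V"
      using False by (intro cInf_greatest)
    then show ?thesis by simp
  qed
  then have "V \<subseteq> {Inf V..Inf V + diameter V}"
    using bounded_imp_bdd_below[OF assms] by (auto intro: cInf_lower)
  then show ?thesis ..
qed auto

text \<open>Coordinates are 1-Lipschitz. An interval, unlike the projection of an arbitrary
  \<open>V\<close>, is always Borel and has length exactly \<open>diameter V\<close>.\<close>

lemma proj_subset_Icc:
  fixes V :: "(real^'n) set"
  assumes "bounded V"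
  shows "\<exists>a. (\<lambda>x. x $ i) ` V \<subseteq> {a..a + diameter V}"
proof (cases "V = {}")
  case False
  let ?W = "(\<lambda>x. x $ i) ` V"
  have b: "bounded ?W"
    using assms by (rule bounded_component_cart)
  have "diameter ?W \<le> diameter V"
  proof (rule diameter_le)
    fix x y assume "x \<in> ?W" "y \<in> ?W"
    then obtain v w where vw: "v \<in> V" "w \<in> V" "x = v $ i" "y = w $ i"
      by blast
    have "dist x y \<le> dist v w"
      unfolding vw by (rule dist_vec_nth_le)
    also have "\<dots> \<le> diameter V"
      by (rule diameter_bounded_bound[OF assms vw(1,2)])
    finally show "norm (x - y) \<le> diameter V"
      by (simp add: dist_norm)
  qed (use False in auto)
  moreover obtain a where "?W \<subseteq> {a..a + diameter ?W}"
    using bounded_real_subset_Icc_diameter[OF b] by blast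
  ultimately have "?W \<subseteq> {a..a + diameter V}"
    by (meson Icc_subset_Ici_iff add_left_mono atLeastatMost_subset_iff order_refl order_trans)
  then show ?thesis ..
qed auto

lemma compact_proj: "compact S \<Longrightarrow> compact ((\<lambda>x::real^'n. x $ i) ` S)"
  by (intro compact_continuous_image continuous_intros)

text \<open>In a cover of \<open>S\<close> by sets of diameter at most \<open>\<delta>\<close>, a
  covering set matters only for those \<open>B c\<close> which it meets. It is thus counted at most
  \<open>M\<close> times, each time with a projection no longer than its diameter.\<close>

lemma sum_proj_le_H1:
  fixes S :: "(real^'n) set" and B :: "'c \<Rightarrow> (real^'n) set"
  assumes J: "finite J" and S: "compact S" and B: "\<And>c. c \<in> J \<Longrightarrow> closed (B c)"
    and \<delta>: "0 < \<delta>" and M: "0 < M"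
    and overlap: "\<And>V. bounded V \<Longrightarrow> diameter V \<le> \<delta> \<Longrightarrow> card {c \<in> J. V \<inter> B c \<noteq> {}} \<le> M"
  shows "(\<Sum>c\<in>J. emeasure lborel ((\<lambda>x. x $ i) ` (S \<inter> B c))) \<le> of_nat M * H1 S"
proof -
  let ?p = "\<lambda>x :: real^'n. x $ i"
  let ?L = "\<Sum>c\<in>J. emeasure lborel (?p ` (S \<inter> B c))"
  have key: "?L \<le> of_nat M * (\<Sum>n. ennreal (diameter (U n)))"
    if U: "S \<subseteq> (\<Union>n. U n)" "\<And>n. bounded (U n)" "\<And>n. diameter (U n) \<le> \<delta>" for U :: "nat \<Rightarrow> (real^'n) set"
  proof -
    obtain a where a: "\<And>n. ?p ` U n \<subseteq> {a n..a n + diameter (U n)}"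
      using proj_subset_Icc[OF U(2)] by metis
    define m where "m n c = (if U n \<inter> B c \<noteq> {} then 1 else 0 :: ennreal)" for n c
    define W where "W n c = (if U n \<inter> B c \<noteq> {} then {a n..a n + diameter (U n)} else {})" for n c
    have W: "emeasure lborel (W n c) = m n c * ennreal (diameter (U n))" for n c
      by (simp add: W_def m_def diameter_ge_0 U)
    have "emeasure lborel (?p ` (S \<inter> B c)) \<le> (\<Sum>n. m n c * ennreal (diameter (U n)))" for c
    proof -
      have "?p ` (S \<inter> B c) \<subseteq> (\<Union>n. W n c)"
      proof
        fix y assume "y \<in> ?p ` (S \<inter> B c)"
        then obtain x n where "y = x $ i" "x \<in> B c" "x \<in> U n"
          using U(1) by blast
        then have "y \<in> W n c"
          using a[of n] by (auto simp: W_def)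
        then show "y \<in> (\<Union>n. W n c)"
          by blast
      qed
      then have "emeasure lborel (?p ` (S \<inter> B c)) \<le> emeasure lborel (\<Union>n. W n c)"
        by (intro emeasure_mono) (auto simp: W_def)
      also have "\<dots> \<le> (\<Sum>n. emeasure lborel (W n c))"
        by (rule emeasure_subadditive_countably) (auto simp: W_def)
      finally show ?thesis
        by (simp add: W)
    qed
    then have "?L \<le> (\<Sum>c\<in>J. \<Sum>n. m n c * ennreal (diameter (U n)))"
      by (intro sum_mono)
    also have "\<dots> = (\<Sum>n. \<Sum>c\<in>J. m n c * ennreal (diameter (U n)))"
      by (rule suminf_sum[symmetric]) auto
    also have "\<dots> \<le> (\<Sum>n. of_nat M * ennreal (diameter (U n)))"
    proof (intro suminf_le summableI)
      fix n
      have "(\<Sum>c\<in>J. m n c) = of_nat (card {c \<in> J. U n \<inter> B c \<noteq> {}})"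
        using J by (simp add: m_def sum.If_cases Int_def)
      also have "\<dots> \<le> of_nat M"
        by (intro of_nat_mono overlap U)
      finally show "(\<Sum>c\<in>J. m n c * ennreal (diameter (U n))) \<le> of_nat M * ennreal (diameter (U n))"
        by (simp add: sum_distrib_right[symmetric] mult_right_mono)
    qed
    also have "\<dots> = of_nat M * (\<Sum>n. ennreal (diameter (U n)))"
      by simp
    finally show ?thesis .
  qed
  \<comment> \<open>The single scale \<open>\<delta>\<close> suffices, because \<open>H1\<close> is
    the supremum over all scales.\<close>
  have "?L / of_nat M \<le> H1_delta \<delta> S"
    unfolding H1_delta_def using M key by (intro INF_greatest divide_le_posI_ennreal) auto
  also have "\<dots> \<le> H1 S"
    unfolding H1_def using \<delta> by (intro SUP_upper) auto
  finally have "of_nat M * (?L / of_nat M) \<le> of_nat M * H1 S"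
    by (rule mult_left_mono) simp
  moreover have "of_nat M * (?L / of_nat M) = ?L"
    using M by (simp add: ennreal_times_divide mult.commute[of "of_nat M"] mult_divide_eq_ennreal)
  ultimately show ?thesis
    by simp
qed

lemma proj_le_H1:
  fixes S :: "(real^'n) set"
  assumes "compact S"
  shows "emeasure lborel ((\<lambda>x. x $ i) ` S) \<le> H1 S"
proof -
  have "card {c \<in> {()}. V \<inter> UNIV \<noteq> {}} \<le> 1" for V :: "(real^'n) set"
    by (rule order_trans[OF card_mono[of "{()}"]]) auto
  from sum_proj_le_H1[of "{()}" S "\<lambda>_. UNIV" 1 1 i, OF _ assms _ _ _ this] show ?thesis
    by simp
qed

section \<open>Segments and the frontier\<close>

lemma segment_avoids_frontier:
  fixes x y :: "'a::real_normed_vector"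
  assumes "closed_segment x y \<inter> frontier E = {}" "x \<in> E"
  shows "y \<in> E"
proof (rule ccontr)
  assume "y \<notin> E"
  then have "closed_segment x y \<inter> E \<noteq> {}" "closed_segment x y - E \<noteq> {}"
    using assms(2) ends_in_segment[of x y] by blast+
  from connected_Int_frontier[OF connected_segment(1) this] assms(1) show False ..
qed

lemma closed_segment_nth_eq:
  fixes x y :: "real^'n"
  assumes "p \<in> closed_segment x y" "x $ i = y $ i"
  shows "p $ i = x $ i"
proof -
  obtain u where "p = (1 - u) *\<^sub>R x + u *\<^sub>R y"
    using assms(1) by (auto simp: closed_segment_def)
  then have "p $ i = (1 - u) * x $ i + u * y $ i"
    by simp
  with assms(2) show ?thesis
    by (simp add: algebra_simps)
qed

lemma proj_subset_proj_frontier: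
  fixes E :: "(real^'n) set"
  assumes "bounded E" "x \<in> E" "i \<noteq> j"
  shows "x $ i \<in> (\<lambda>x. x $ i) ` frontier E"
proof -
  obtain K where K: "\<And>y. y \<in> E \<Longrightarrow> norm y \<le> K"
    using assms(1) by (auto simp: bounded_iff)
  \<comment> \<open>Moving in direction \<open>j\<close> leaves the bounded set \<open>E\<close>
    without changing coordinate \<open>i\<close>; the segment must cross the frontier on the
    way.\<close>
  define y :: "real^'n" where "y = (\<chi> l. if l = j then K + 1 else x $ l)"
  have "K + 1 \<le> norm y"
    using component_le_norm_cart[of y j] by (simp add: y_def)
  then have "y \<notin> E"
    using K by fastforce
  then obtain p where "p \<in> closed_segment x y" "p \<in> frontier E"
    using segment_avoids_frontier[of x y E] assms(2) by blast
  moreover have "x $ i = y $ i"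
    using assms(3) by (simp add: y_def)
  ultimately have "p $ i = x $ i" "p \<in> frontier E"
    using closed_segment_nth_eq[of p x y i] by auto
  then show ?thesis
    by (metis image_eqI)
qed

text \<open>\<open>E\<close> lies in the product of the two projections of its frontier, each of
  length at most \<open>H1 (frontier E)\<close>.\<close>

lemma isoperimetric_crude:
  fixes E :: "(real^2) set"
  assumes "bounded E"
  shows "emeasure lborel E \<le> (H1 (frontier E))\<^sup>2"
proof -
  let ?X = "\<lambda>i :: 2. (\<lambda>x. x $ i) ` frontier E"
  have c: "compact (frontier E)"
    using assms by (simp add: compact_frontier_bounded)
  have X: "?X i \<in> sets borel" for i :: 2
    using compact_proj[OF c] by (intro borel_compact)
  have ne: "(1::2) \<noteq> 2"
    by simp
  have "E \<subseteq> {x :: real^2. x $ 1 \<in> ?X 1 \<and> x $ 2 \<in> ?X 2}"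
  proof (intro subsetI CollectI conjI)
    fix x assume "x \<in> E"
    then show "x $ 1 \<in> ?X 1" "x $ 2 \<in> ?X 2"
      using proj_subset_proj_frontier[OF assms] ne by metis+
  qed
  then have "emeasure lborel E \<le> emeasure lborel {x :: real^2. x $ 1 \<in> ?X 1 \<and> x $ 2 \<in> ?X 2}"
    using X by (intro emeasure_mono) auto
  also have "\<dots> = emeasure lborel (?X 1) * emeasure lborel (?X 2)"
    by (rule emeasure_lborel_rectangle[OF ne X X])
  also have "\<dots> \<le> (H1 (frontier E))\<^sup>2"
    unfolding power2_eq_square using proj_le_H1[OF c] by (intro mult_mono) auto
  finally show ?thesis .
qed

text \<open>Walk inside the box from \<open>x\<close> in direction \<open>i\<close> and then in direction \<open>j\<close> to \<open>p\<close>; the second leg avoids the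
  frontier of \<open>E\<close>, so the first one must meet it.\<close>

lemma box_slab_subset:
  fixes E B :: "(real^2) set"
  defines "X \<equiv> \<lambda>i. (\<lambda>x. x $ i) ` (frontier E \<inter> B)"
  assumes B: "B = cbox l u" and p: "p \<in> B - E" "p $ i \<notin> X i" and "i \<noteq> j"
    and x: "x \<in> E \<inter> B"
  shows "x $ j \<in> X j"
proof (rule ccontr)
  assume xj: "x $ j \<notin> X j"
  have ij: "k = i \<or> k = j" for k
    using \<open>i \<noteq> j\<close> exhaust_2[of i] exhaust_2[of j] exhaust_2[of k] by auto
  define q :: "real^2" where "q = (\<chi> k. if k = i then p $ i else x $ k)"
  have q: "q $ i = p $ i" "q $ j = x $ j"
    using \<open>i \<noteq> j\<close> by (auto simp: q_def)
  have "q \<in> B"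
    using p x unfolding B q_def by (auto simp: mem_box_cart)
  then have sub: "closed_segment x q \<subseteq> B" "closed_segment q p \<subseteq> B"
    using x p unfolding B by (simp_all add: closed_segment_subset)
  have "y $ j = x $ j" if "y \<in> closed_segment x q" for y
    using closed_segment_nth_eq[OF that, of j] q by simp
  moreover have "y $ j \<in> X j" if "y \<in> closed_segment x q" "y \<in> frontier E" for y
    unfolding X_def using that sub(1) by (intro imageI) blast
  ultimately have "closed_segment x q \<inter> frontier E = {}"
    using xj by (metis disjoint_iff)
  then have "q \<in> E"
    using x segment_avoids_frontier by blast
  have "y $ i = p $ i" if "y \<in> closed_segment q p" for y
    using closed_segment_nth_eq[OF that, of i] q by simp
  moreover have "y $ i \<in> X i" if "y \<in> closed_segment q p" "y \<in> frontier E" for y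
    unfolding X_def using that sub(2) by (intro imageI) blast
  ultimately have "closed_segment q p \<inter> frontier E = {}"
    using p(2) by (metis disjoint_iff)
  with \<open>q \<in> E\<close> have "p \<in> E"
    using segment_avoids_frontier by blast
  with p show False by blast
qed

lemma emeasure_real_reflect_translate:
  fixes X :: "real set"
  assumes "compact X"
  shows "emeasure lborel ((\<lambda>x. x - a) ` X) = emeasure lborel X"
    and "emeasure lborel ((\<lambda>x. a - x) ` X) = emeasure lborel X"
proof -
  have X: "X \<in> sets borel"
    using assms by (rule borel_compact)
  have c: "compact ((\<lambda>x. x - a) ` X)" "compact ((\<lambda>x. a - x) ` X)"
    using assms by (auto intro!: compact_continuous_image continuous_intros)
  note b = c[THEN borel_compact]
  show "emeasure lborel ((\<lambda>x. x - a) ` X) = emeasure lborel X"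
    using emeasure_lebesgue_affine[of 1 "-a" X] b X by simp
  show "emeasure lborel ((\<lambda>x. a - x) ` X) = emeasure lborel X"
    using emeasure_lebesgue_affine[of "-1" a X] b X by simp
qed

text \<open>If the projections of the frontier are so short that some \<open>t\<close> misses them, then a complement point
  at distance \<open>t\<close> confines \<open>E \<inter> B\<close> to a slab. Otherwise the projections are comparable to \<open>s\<close>.\<close>

lemma emeasure_box_le:
  fixes E B :: "(real^2) set"
  defines "X \<equiv> \<lambda>i. (\<lambda>x. x $ i) ` (frontier E \<inter> B)"
  assumes s: "0 < s" and E: "bounded E" and B: "B = cbox l u" "\<And>i. u $ i - l $ i = 3 * s"
    and p: "\<And>t. 0 < t \<Longrightarrow> t < s \<Longrightarrow> \<exists>p\<in>B - E. \<exists>i. p $ i = z $ i + t \<or> p $ i = z $ i - t"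
  shows "emeasure lborel (E \<inter> B) \<le> ennreal (18 * s) * (emeasure lborel (X 1) + emeasure lborel (X 2))"
proof -
  have cX: "compact (X i)" for i
    unfolding X_def B using E by (intro compact_proj compact_Int) (auto simp: compact_frontier_bounded)
  have bX: "X i \<in> sets borel" for i
    using cX by (rule borel_compact)
  \<comment> \<open>\<open>T i\<close> consists of those \<open>t\<close> for which
    \<open>z $ i + t\<close> or \<open>z $ i - t\<close> is a coordinate of a frontier point in the
    box.\<close>
  define T where "T i = (\<lambda>x. x - z $ i) ` X i \<union> (\<lambda>x. z $ i - x) ` X i" for i
  have bT1: "(\<lambda>x. x - z $ i) ` X i \<in> sets borel" "(\<lambda>x. z $ i - x) ` X i \<in> sets borel" for i
    using cX[of i] by (auto intro!: borel_compact compact_continuous_image continuous_intros)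
  then have bT: "T i \<in> sets borel" for i
    by (auto simp: T_def)
  have T: "emeasure lborel (T i) \<le> 2 * emeasure lborel (X i)" for i
    unfolding T_def mult_2
    using emeasure_subadditive[of "(\<lambda>x. x - z $ i) ` X i" lborel "(\<lambda>x. z $ i - x) ` X i"] bT1
      emeasure_real_reflect_translate[OF cX[of i], of "z $ i"] by simp
  show ?thesis
  proof (cases "{0<..<s} \<subseteq> T 1 \<union> T 2")
    case True
    have "ennreal s = emeasure lborel {0<..<s}"
      using s by simp
    also have "\<dots> \<le> emeasure lborel (T 1 \<union> T 2)"
      using bT True by (intro emeasure_mono) auto
    also have "\<dots> \<le> emeasure lborel (T 1) + emeasure lborel (T 2)"
      using bT by (intro emeasure_subadditive) auto
    also have "\<dots> \<le> 2 * (emeasure lborel (X 1) + emeasure lborel (X 2))"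
      unfolding distrib_left by (intro add_mono T)
    finally have *: "ennreal s \<le> 2 * (emeasure lborel (X 1) + emeasure lborel (X 2))" .
    \<comment> \<open>The box itself has area \<open>9 * s\<^sup>2\<close>, and one factor
      \<open>s\<close> is replaced by twice the projections: this gives 18. The slab case below
      needs only 3.\<close>
    have "emeasure lborel (E \<inter> B) \<le> emeasure lborel {x :: real^2. x $ 1 \<in> {l $ 1..u $ 1} \<and> x $ 2 \<in> {l $ 2..u $ 2}}"
      by (intro emeasure_mono) (auto simp: B mem_box_cart)
    also have "\<dots> = ennreal (3 * s) * ennreal (3 * s)"
      using B(2)[of 1] B(2)[of 2] s by (subst emeasure_lborel_rectangle) auto
    also have "\<dots> = ennreal (9 * s) * ennreal s"
      using s by (simp add: ennreal_mult[symmetric])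
    also have "\<dots> \<le> ennreal (9 * s) * (2 * (emeasure lborel (X 1) + emeasure lborel (X 2)))"
      using * by (intro mult_left_mono) auto
    also have "\<dots> = ennreal (9 * s) * ennreal 2 * (emeasure lborel (X 1) + emeasure lborel (X 2))"
      by (simp add: mult.assoc)
    also have "ennreal (9 * s) * ennreal 2 = ennreal (18 * s)"
      using s by (subst ennreal_mult[symmetric]) auto
    finally show ?thesis .
  next
    case False
    then obtain t where t: "0 < t" "t < s" "t \<notin> T 1" "t \<notin> T 2"
      by (meson UnI1 UnI2 greaterThanLessThan_iff subsetI)
    obtain p i where pi: "p \<in> B - E" "p $ i = z $ i + t \<or> p $ i = z $ i - t"
      using p[OF t(1,2)] by blast
    have "t \<notin> T i"
      using t exhaust_2[of i] by auto
    with pi have px: "p $ i \<notin> X i"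
      by (force simp: T_def image_iff)
    obtain j where ij: "i \<noteq> j"
      using exhaust_2[of i] by (metis one_neq_zero zero_neq_one)
    have "E \<inter> B \<subseteq> {x. x $ i \<in> {l $ i..u $ i} \<and> x $ j \<in> X j}"
      using box_slab_subset[OF B(1) pi(1) px[unfolded X_def] ij] unfolding X_def by (auto simp: B mem_box_cart)
    then have "emeasure lborel (E \<inter> B) \<le> emeasure lborel {x. x $ i \<in> {l $ i..u $ i} \<and> x $ j \<in> X j}"
      using bX by (intro emeasure_mono) auto
    also have "\<dots> = ennreal (3 * s) * emeasure lborel (X j)"
      using B(2)[of i] s bX by (subst emeasure_lborel_rectangle[OF ij]) auto
    also have "\<dots> \<le> ennreal (18 * s) * (emeasure lborel (X 1) + emeasure lborel (X 2))"
      using s exhaust_2[of j] by (intro mult_mono) (auto intro: ennreal_leI)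
    finally show ?thesis .
  qed
qed

section \<open>Connected sets in the compactification\<close>

lemma component_meets_box_boundary:
  fixes z :: "real^'n"
  assumes C: "connectedin (Alexandroff_compactification euclidean) C"
    and z: "Some z \<in> C" and q: "q \<in> C" "q \<notin> Some ` box (z - vec s) (z + vec s)"
    and t: "0 < t" "t < s"
  shows "\<exists>p \<in> cbox (z - vec t) (z + vec t). Some p \<in> C \<and> (\<exists>i. p $ i = z $ i + t \<or> p $ i = z $ i - t)"
proof (rule ccontr)
  assume neg: "\<not> ?thesis"
  let ?X = "Alexandroff_compactification (euclidean :: (real^'n) topology)"
  \<comment> \<open>If \<open>C\<close> missed the boundary of the square of half-side
    \<open>t\<close>, then its interior \<open>U\<close> and its exterior \<open>V\<close> would
    separate \<open>C\<close>. Since \<open>C\<close> may reach infinity, \<open>None\<close> is put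
    into \<open>V\<close>, which is open as the complement of a compact square.\<close>
  define U where "U = Some ` box (z - vec t) (z + vec t)"
  define V where "V = insert None (Some ` (topspace euclidean - cbox (z - vec t) (z + vec t)))"
  have "openin ?X U"
    unfolding U_def openin_Alexandroff_compactification_image_Some by (simp add: open_box)
  moreover have "openin ?X V"
    unfolding openin_Alexandroff_compactification V_def
    by (intro disjI2 exI[of _ "cbox (z - vec t) (z + vec t)"]) auto
  moreover have "C \<subseteq> U \<union> V"
  proof
    fix w assume w: "w \<in> C"
    show "w \<in> U \<union> V"
    proof (cases w)
      case (Some p)
      show ?thesis
      proof (cases "p \<in> cbox (z - vec t) (z + vec t)")
        case True
        with neg w Some have "p $ i \<noteq> z $ i + t \<and> p $ i \<noteq> z $ i - t" for i
          by blast
        with True have "p \<in> box (z - vec t) (z + vec t)"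
          unfolding mem_box_cart by (metis order_le_less vector_add_component vector_minus_component vec_component)
        with Some show ?thesis
          by (simp add: U_def)
      qed (simp add: Some V_def)
    qed (simp add: V_def)
  qed
  moreover have "U \<inter> V = {}"
    using box_subset_cbox[of "z - vec t" "z + vec t"] by (auto simp: U_def V_def)
  moreover have "Some z \<in> U"
    using t by (auto simp: U_def mem_box_cart)
  moreover have "q \<in> V"
  proof -
    have "cbox (z - vec t) (z + vec t) \<subseteq> box (z - vec s) (z + vec s)"
    proof
      fix x assume "x \<in> cbox (z - vec t) (z + vec t)"
      then have "z $ i - t \<le> x $ i" "x $ i \<le> z $ i + t" for i
        by (simp_all add: mem_box_cart)
      then have "z $ i - s < x $ i" "x $ i < z $ i + s" for i
        using t by (smt (verit))+
      then show "x \<in> box (z - vec s) (z + vec s)"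
        by (simp add: mem_box_cart)
    qed
    then show ?thesis
      using q(2) by (cases q) (auto simp: V_def)
  qed
  ultimately show False
    using C z q(1) unfolding connectedin by blast
qed

section \<open>Area and perimeter in multiply connected sets\<close>

definition cell :: "real \<Rightarrow> int^'n \<Rightarrow> (real^'n) set" where
  "cell s c = cbox (\<chi> i. s * of_int (c $ i)) (\<chi> i. s * (of_int (c $ i) + 1))"

text \<open>The cell enlarged by \<open>s\<close> on every side: it contains all squares of
  half-side below \<open>s\<close> centred in the cell.\<close>

definition cell3 :: "real \<Rightarrow> int^'n \<Rightarrow> (real^'n) set" where
  "cell3 s c = cbox (\<chi> i. s * (of_int (c $ i) - 1)) (\<chi> i. s * (of_int (c $ i) + 2))"

lemma mem_cell: "x \<in> cell s c \<longleftrightarrow> (\<forall>i. s * of_int (c $ i) \<le> x $ i \<and> x $ i \<le> s * of_int (c $ i) + s)"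
  by (simp add: cell_def mem_box_cart algebra_simps)

lemma mem_cell3:
  "x \<in> cell3 s c \<longleftrightarrow> (\<forall>i. s * of_int (c $ i) - s \<le> x $ i \<and> x $ i \<le> s * of_int (c $ i) + 2 * s)"
  by (simp add: cell3_def mem_box_cart algebra_simps)

lemma ex_cell:
  assumes "0 < s"
  shows "\<exists>c. x \<in> cell s c"
proof -
  have "s * of_int \<lfloor>x $ i / s\<rfloor> \<le> x $ i \<and> x $ i \<le> s * of_int \<lfloor>x $ i / s\<rfloor> + s" for i
  proof -
    have "x $ i = s * (x $ i / s)" "of_int \<lfloor>x $ i / s\<rfloor> \<le> x $ i / s" "x $ i / s \<le> of_int \<lfloor>x $ i / s\<rfloor> + 1"
      using assms by (simp, linarith+)
    then show ?thesis
      using mult_left_mono[of "of_int \<lfloor>x $ i / s\<rfloor>" "x $ i / s" s]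
        mult_left_mono[of "x $ i / s" "of_int \<lfloor>x $ i / s\<rfloor> + 1" s] assms
      by (simp add: distrib_left)
  qed
  then show ?thesis
    by (intro exI[of _ "\<chi> i. \<lfloor>x $ i / s\<rfloor>"]) (simp add: mem_cell)
qed

lemma cells_near:
  fixes d :: "int^2" and n :: nat
  defines "N \<equiv> {c. \<forall>i. \<bar>c $ i - d $ i\<bar> \<le> int n}"
  shows "finite N" "card N \<le> (2 * n + 1)\<^sup>2"
proof -
  let ?f = "\<lambda>c :: int^2. (c $ 1, c $ 2)"
  let ?I = "\<lambda>i. {d $ i - int n..d $ i + int n}"
  have sub: "?f ` N \<subseteq> ?I 1 \<times> ?I 2"
    by (auto simp: N_def abs_le_iff algebra_simps)
  have inj: "inj_on ?f N"
    by (auto simp: inj_on_def vec_eq_iff forall_2)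
  show "finite N"
    using inj_on_finite[OF inj sub] by simp
  have "card N \<le> card (?I 1 \<times> ?I 2)"
    using inj sub by (intro card_inj_on_le[of ?f]) auto
  also have "\<dots> = (2 * n + 1)\<^sup>2"
  proof -
    have "card (?I i) = nat (int (2 * n + 1))" for i
      by (simp add: algebra_simps)
    then have "card (?I i) = 2 * n + 1" for i
      unfolding nat_int .
    then show ?thesis
      unfolding card_cartesian_product power2_eq_square by simp
  qed
  finally show "card N \<le> (2 * n + 1)\<^sup>2" .
qed

text \<open>Enlarged cells have side \<open>3 * s\<close>, so two of them that meet a set of
  diameter at most \<open>s\<close> have indices differing by at most 4 in each coordinate; 81 =
  9^2.\<close>

lemma cell3_overlap:
  fixes V :: "(real^2) set"
  assumes s: "0 < s" and V: "bounded V" "diameter V \<le> s" and J: "finite J"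
  shows "card {c \<in> J. V \<inter> cell3 s c \<noteq> {}} \<le> 81"
proof (cases "{c \<in> J. V \<inter> cell3 s c \<noteq> {}} = {}")
  case False
  then obtain d v where d: "v \<in> V" "v \<in> cell3 s d"
    by blast
  let ?N = "{c. \<forall>i. \<bar>c $ i - d $ i\<bar> \<le> int 4}"
  have "{c \<in> J. V \<inter> cell3 s c \<noteq> {}} \<subseteq> ?N"
  proof (intro subsetI CollectI allI)
    fix c i assume "c \<in> {c \<in> J. V \<inter> cell3 s c \<noteq> {}}"
    then obtain w where w: "w \<in> V" "w \<in> cell3 s c"
      by blast
    have "dist (w $ i) (v $ i) \<le> dist w v"
      by (rule dist_vec_nth_le)
    also have "\<dots> \<le> s"
      using diameter_bounded_bound[OF V(1) w(1) d(1)] V(2) by simp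
    finally have "\<bar>w $ i - v $ i\<bar> \<le> s"
      by (simp add: dist_real_def)
    moreover have "s * of_int (c $ i) - s \<le> w $ i" "w $ i \<le> s * of_int (c $ i) + 2 * s"
      "s * of_int (d $ i) - s \<le> v $ i" "v $ i \<le> s * of_int (d $ i) + 2 * s"
      using w(2) d(2) by (auto simp: mem_cell3)
    ultimately have "s * of_int (c $ i) \<le> s * (of_int (d $ i) + 4)" "s * of_int (d $ i) \<le> s * (of_int (c $ i) + 4)"
      by (simp_all add: distrib_left)
    then show "\<bar>c $ i - d $ i\<bar> \<le> int 4"
      using s by simp
  qed
  then have "card {c \<in> J. V \<inter> cell3 s c \<noteq> {}} \<le> card ?N"
    by (rule card_mono[OF cells_near(1)])
  also have "\<dots> \<le> (2 * 4 + 1)\<^sup>2"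
    by (rule cells_near(2))
  finally show ?thesis
    by simp
next
  case True
  then show ?thesis
    by (simp only: True card.empty)
qed

lemma finite_cells_meeting:
  fixes E :: "(real^2) set"
  assumes "bounded E" "0 < s"
  shows "finite {c. cell s c \<inter> E \<noteq> {}}"
proof -
  obtain K where K: "\<And>x. x \<in> E \<Longrightarrow> norm x \<le> K"
    using assms(1) by (auto simp: bounded_iff)
  obtain n :: nat where n: "K / s + 1 \<le> n"
    \<comment> \<open>The summand 1 makes room for the side length of a cell.\<close>
    using real_arch_simple by blast
  have "{c. cell s c \<inter> E \<noteq> {}} \<subseteq> {c. \<forall>i. \<bar>c $ i - 0 $ i\<bar> \<le> int n}"
  proof (intro subsetI CollectI allI)
    fix c i assume "c \<in> {c. cell s c \<inter> E \<noteq> {}}"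
    then obtain x where x: "x \<in> cell s c" "x \<in> E"
      by blast
    have "\<bar>x $ i\<bar> \<le> K"
      using K[OF x(2)] component_le_norm_cart[of x i] by linarith
    also have "K \<le> s * n - s"
      using n assms(2) by (simp add: field_simps)
    finally have "x $ i \<le> s * n - s" "- (s * n - s) \<le> x $ i"
      by simp_all
    moreover have "s * of_int (c $ i) \<le> x $ i" "x $ i \<le> s * of_int (c $ i) + s"
      using x(1) by (auto simp: mem_cell)
    ultimately have "s * of_int (c $ i) \<le> s * n" "- (s * n) \<le> s * of_int (c $ i)"
      using assms(2) by linarith+
    then have "real_of_int (c $ i) \<le> n" "- real n \<le> real_of_int (c $ i)"
      using mult_le_cancel_left_pos[OF assms(2), of "- real n" "of_int (c $ i)"] assms(2) by simp_all
    then show "\<bar>c $ i - 0 $ i\<bar> \<le> int n"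
      by simp
  qed
  then show ?thesis
    by (rule finite_subset) (rule cells_near(1))
qed

text \<open>Used in contrapositive form: for small \<open>s\<close> the inequality fails, so some
  cell lies in \<open>\<Omega>\<close>.\<close>

lemma measure_le_perimeter:
  fixes E \<Omega> :: "(real^2) set"
  assumes mc: "multiply_connected k \<Omega>" "k \<noteq> 0"
    and E: "open E" "bounded E" "E \<subseteq> \<Omega>"
    and s: "0 < s" and cells: "\<And>c. \<not> cell s c \<subseteq> \<Omega>"
    and P: "H1 (frontier E) = ennreal P" "0 \<le> P"
  shows "measure lborel E \<le> 3000 * sqrt k * s * P"
proof -
  let ?X = "Alexandroff_compactification (euclidean :: (real^2) topology)"
  define Y where "Y = subtopology ?X (topspace ?X - Some ` \<Omega>)"
  have CC: "finite (connected_components_of Y)" "card (connected_components_of Y) = k"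
    using mc(1) by (simp_all add: multiply_connected_def Y_def Let_def)
  obtain z where z: "\<And>c. z c \<in> cell s c" "\<And>c. z c \<notin> \<Omega>"
  proof -
    have "\<exists>x. x \<in> cell s c \<and> x \<notin> \<Omega>" for c
      using cells by blast
    then show ?thesis
      using that by metis
  qed
  \<comment> \<open>\<open>comp c\<close> may contain \<open>None\<close>; the cell is then not in
    \<open>Bad\<close>, since the inclusion required there fails.\<close>
  define comp where "comp c = connected_component_of_set Y (Some (z c))" for c
  have zY: "Some (z c) \<in> topspace Y" for c
    using z(2)[of c] by (auto simp: Y_def)
  then have comp: "comp c \<in> connected_components_of Y" "Some (z c) \<in> comp c" for c
    unfolding comp_def
    by (simp_all add: connected_component_in_connected_components_of connected_component_of_refl)
  have "connectedin Y (comp c)" for c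
    unfolding comp_def by (rule connectedin_connected_component_of)
  then have compX: "connectedin ?X (comp c)" "comp c \<subseteq> - Some ` \<Omega>" for c
    unfolding Y_def by (auto simp: connectedin_subtopology)
  define J where "J = {c. cell s c \<inter> E \<noteq> {}}"
  \<comment> \<open>cells whose chosen complement point lies in a small complement component\<close>
  define Bad where "Bad = {c \<in> J. comp c \<subseteq> Some ` box (z c - vec s) (z c + vec s)}"
  define Good where "Good = J - Bad"
  have J: "finite J"
    unfolding J_def using E s by (intro finite_cells_meeting)
  then have fin: "finite Bad" "finite Good"
    by (auto simp: Bad_def Good_def)
  have card_Bad: "card Bad \<le> 9 * k"
  proof -
    \<comment> \<open>If two bad cells share a component, the chosen point of one lies in the open
      square of half-side \<open>s\<close> around that of the other. The indices then differ by less
      than 2, which leaves 3^2 cells.\<close>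
    have fib: "card {c \<in> Bad. comp c = K} \<le> 9" for K
    proof (cases "{c \<in> Bad. comp c = K} = {}")
      case False
      then obtain d where d: "d \<in> Bad" "comp d = K"
        by blast
      let ?N = "{c. \<forall>i. \<bar>c $ i - d $ i\<bar> \<le> int 1}"
      have "{c \<in> Bad. comp c = K} \<subseteq> ?N"
      proof clarify
        fix c i assume c: "c \<in> Bad" "K = comp c"
        have "z c \<in> box (z d - vec s) (z d + vec s)"
          using comp(2)[of c] c d by (auto simp: Bad_def)
        then have "z d $ i - s < z c $ i" "z c $ i < z d $ i + s"
          by (simp_all add: mem_box_cart)
        moreover have "s * of_int (c $ i) \<le> z c $ i" "z c $ i \<le> s * of_int (c $ i) + s"
          "s * of_int (d $ i) \<le> z d $ i" "z d $ i \<le> s * of_int (d $ i) + s"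
          using z(1)[of c] z(1)[of d] by (auto simp: mem_cell)
        ultimately have "s * of_int (c $ i) < s * (of_int (d $ i) + 2)" "s * of_int (d $ i) < s * (of_int (c $ i) + 2)"
          by (simp_all add: distrib_left)
        then have "real_of_int (c $ i) < of_int (d $ i) + 2" "real_of_int (d $ i) < of_int (c $ i) + 2"
          using s by simp_all
        then show "\<bar>c $ i - d $ i\<bar> \<le> int 1"
          by linarith
      qed
      then have "card {c \<in> Bad. comp c = K} \<le> card ?N"
        by (rule card_mono[OF cells_near(1)])
      also have "\<dots> \<le> (2 * 1 + 1)\<^sup>2"
        by (rule cells_near(2))
      finally show ?thesis
        by simp
    next
      case True
      then show ?thesis
        by (simp only: True card.empty)
    qed
    have "card Bad = (\<Sum>K\<in>comp ` Bad. card {c \<in> Bad. comp c = K})"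
      using sum.image_gen[OF fin(1), of "\<lambda>_. 1 :: nat" comp] by simp
    also have "\<dots> \<le> (\<Sum>K\<in>comp ` Bad. 9)"
      by (intro sum_mono fib)
    also have "\<dots> \<le> 9 * card (connected_components_of Y)"
      using comp(1) CC by (auto intro!: card_mono)
    finally show ?thesis
      by (simp add: CC)
  qed
  let ?pr = "\<lambda>i c. emeasure lborel ((\<lambda>x. x $ i) ` (frontier E \<inter> cell3 s c))"
  \<comment> \<open>A good component leaves the square around \<open>z c\<close>, so for each
    \<open>t < s\<close> it has a point on the boundary of the square of half-side \<open>t\<close>;
    that point lies in \<open>cell3 s c\<close> and outside \<open>E\<close>.\<close>
  have good: "emeasure lborel (E \<inter> cell3 s c) \<le> ennreal (18 * s) * (?pr 1 c + ?pr 2 c)" if "c \<in> Good" for c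
  proof (rule emeasure_box_le[OF s E(2) cell3_def])
    have "c \<notin> Bad" "c \<in> J"
      using that by (auto simp: Good_def)
    then obtain q where q: "q \<in> comp c" "q \<notin> Some ` box (z c - vec s) (z c + vec s)"
      by (auto simp: Bad_def)
    fix t assume t: "0 < t" "t < s"
    obtain p where p: "p \<in> cbox (z c - vec t) (z c + vec t)" "Some p \<in> comp c"
      "\<exists>i. p $ i = z c $ i + t \<or> p $ i = z c $ i - t"
      using component_meets_box_boundary[OF compX(1) comp(2) q t] by blast
    have "p \<notin> E"
      using p(2) compX(2)[of c] E(3) by blast
    moreover have "p \<in> cell3 s c"
      unfolding mem_cell3
    proof
      fix i
      have "z c $ i - t \<le> p $ i" "p $ i \<le> z c $ i + t"
        using p(1) by (simp_all add: mem_box_cart)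
      moreover have "s * of_int (c $ i) \<le> z c $ i" "z c $ i \<le> s * of_int (c $ i) + s"
        using z(1)[of c] by (auto simp: mem_cell)
      ultimately show "s * of_int (c $ i) - s \<le> p $ i \<and> p $ i \<le> s * of_int (c $ i) + 2 * s"
        using t by linarith
    qed
    ultimately show "\<exists>p\<in>cell3 s c - E. \<exists>i. p $ i = z c $ i + t \<or> p $ i = z c $ i - t"
      using p(3) by blast
  qed (simp add: algebra_simps)
  have cell_sub: "cell s c \<subseteq> cell3 s c" for c :: "int^2"
  proof
    fix x assume "x \<in> cell s c"
    then have "s * of_int (c $ i) \<le> x $ i" "x $ i \<le> s * of_int (c $ i) + s" for i
      by (simp_all add: mem_cell)
    then show "x \<in> cell3 s c"
      unfolding mem_cell3 using s by (smt (verit))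
  qed
  have borel: "E \<in> sets borel" "cell s c \<in> sets borel" "cell3 s c \<in> sets borel" for c :: "int^2"
    using E(1) by (auto simp: cell_def cell3_def)
  define G where "G = (\<Union>c\<in>Good. E \<inter> cell s c)"
  define D where "D = (\<Union>c\<in>Bad. E \<inter> cell s c)"
  have GD: "G \<in> sets borel" "D \<in> sets borel" "E = G \<union> D"
  proof -
    show "G \<in> sets borel" "D \<in> sets borel"
      unfolding G_def D_def using borel fin by (auto intro!: sets.finite_UN)
    show "E = G \<union> D"
    proof
      show "E \<subseteq> G \<union> D"
      proof
        fix x assume "x \<in> E"
        moreover obtain c where "x \<in> cell s c"
          using ex_cell[OF s] by blast
        ultimately show "x \<in> G \<union> D"
          by (auto simp: G_def D_def Good_def J_def)
      qed
    qed (auto simp: G_def D_def)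
  qed
  \<comment> \<open>Closed cells overlap along their edges, which is harmless for
    subadditivity.\<close>
  have "emeasure lborel G \<le> (\<Sum>c\<in>Good. emeasure lborel (E \<inter> cell s c))"
    unfolding G_def using borel fin by (intro emeasure_subadditive_finite) auto
  also have "\<dots> \<le> (\<Sum>c\<in>Good. emeasure lborel (E \<inter> cell3 s c))"
    using cell_sub borel by (intro sum_mono emeasure_mono) auto
  also have "\<dots> \<le> (\<Sum>c\<in>Good. ennreal (18 * s) * (?pr 1 c + ?pr 2 c))"
    by (intro sum_mono good)
  also have "\<dots> = ennreal (18 * s) * ((\<Sum>c\<in>Good. ?pr 1 c) + (\<Sum>c\<in>Good. ?pr 2 c))"
    by (simp add: sum_distrib_left sum.distrib distrib_left)
  also have "\<dots> \<le> ennreal (18 * s) * (of_nat 81 * ennreal P + of_nat 81 * ennreal P)"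
  proof -
    have "(\<Sum>c\<in>Good. ?pr i c) \<le> of_nat 81 * ennreal P" for i
      unfolding P(1)[symmetric]
    proof (rule sum_proj_le_H1[OF fin(2) _ _ s])
      show "compact (frontier E)"
        using E(2) by (rule compact_frontier_bounded)
      show "card {c \<in> Good. V \<inter> cell3 s c \<noteq> {}} \<le> 81" if "bounded V" "diameter V \<le> s" for V
        using cell3_overlap[OF s that fin(2)] .
    qed (auto simp: cell3_def)
    then show ?thesis
      by (intro mult_left_mono add_mono) auto
  qed
  \<comment> \<open>Two coordinate directions with overlap 81 each: 18 * 2 * 81 = 2916.\<close>
  also have "\<dots> = ennreal (2916 * s * P)"
  proof -
    have "of_nat 81 * ennreal P + of_nat 81 * ennreal P = ennreal (162 * P)"
    proof -
      have "of_nat 81 * ennreal P = ennreal (81 * P)"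
        using ennreal_mult[of 81 P] P(2) by simp
      then show ?thesis
        using ennreal_plus[of "81 * P" "81 * P"] P(2) by (simp del: ennreal_plus)
    qed
    then show ?thesis
      using s P(2) by (simp add: ennreal_mult[symmetric])
  qed
  finally have G: "measure lborel G \<le> 2916 * s * P"
    unfolding measure_def using s P(2) by (intro enn2real_leI) auto
  have "emeasure lborel D \<le> (\<Sum>c\<in>Bad. emeasure lborel (E \<inter> cell s c))"
    unfolding D_def using borel fin by (intro emeasure_subadditive_finite) auto
  also have "\<dots> \<le> (\<Sum>c\<in>Bad. ennreal (s * s))"
  proof (rule sum_mono)
    fix c :: "int^2"
    have "emeasure lborel (E \<inter> cell s c) \<le> emeasure lborel
      {x :: real^2. x $ 1 \<in> {s * of_int (c $ 1)..s * of_int (c $ 1) + s} \<and> x $ 2 \<in> {s * of_int (c $ 2)..s * of_int (c $ 2) + s}}"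
      by (intro emeasure_mono) (auto simp: mem_cell)
    also have "\<dots> = ennreal (s * s)"
      using s by (subst emeasure_lborel_rectangle) (auto simp: ennreal_mult)
    finally show "emeasure lborel (E \<inter> cell s c) \<le> ennreal (s * s)" .
  qed
  also have "\<dots> = ennreal (card Bad * (s * s))"
    using s by (simp add: ennreal_of_nat_eq_real_of_nat ennreal_mult)
  also have "\<dots> \<le> ennreal (9 * k * (s * s))"
    using card_Bad s by (intro ennreal_leI mult_right_mono) (auto simp flip: of_nat_le_iff)
  finally have D1: "measure lborel D \<le> 9 * k * (s * s)"
    unfolding measure_def using s by (intro enn2real_leI) auto
  have "emeasure lborel E \<le> ennreal (P\<^sup>2)"
    using isoperimetric_crude[OF E(2)] P by (simp add: ennreal_power)
  then have E2: "measure lborel E \<le> P\<^sup>2"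
    unfolding measure_def by (intro enn2real_leI) auto
  have finE: "emeasure lborel E < \<infinity>"
    using E(2) by (rule emeasure_bounded_finite)
  have D2: "measure lborel D \<le> measure lborel E"
    using GD finE by (intro measure_mono_fmeasurable) (auto simp: fmeasurable_def)
  \<comment> \<open>The geometric mean of the counting bound \<open>9 * k * s\<^sup>2\<close> and
    the isoperimetric bound \<open>P\<^sup>2\<close> makes the area of \<open>D\<close> linear in
    \<open>s * P\<close> and reduces \<open>k\<close> to \<open>sqrt k\<close>.\<close>
  have "(measure lborel D)\<^sup>2 \<le> (9 * k * (s * s)) * P\<^sup>2"
    unfolding power2_eq_square[of "measure lborel D"] using D1 D2 E2 s by (intro mult_mono) auto
  also have "\<dots> = (3 * sqrt k * s * P)\<^sup>2"
    by (simp add: power_mult_distrib power2_eq_square)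
  finally have D: "measure lborel D \<le> 3 * sqrt k * s * P"
    by (rule power2_le_imp_le) (use s P(2) in auto)
  have "measure lborel E \<le> measure lborel G + measure lborel D"
    unfolding GD(3) using GD finE by (intro measure_Un_le) auto
  also have "\<dots> \<le> 2916 * (1 * s * P) + 3 * (sqrt k * s * P)"
    using G D by simp
  \<comment> \<open>Here \<open>1 \<le> sqrt k\<close> enters, from
    \<open>k \<noteq> 0\<close>.\<close>
  also have "\<dots> \<le> 2916 * (sqrt k * s * P) + 3 * (sqrt k * s * P)"
    using mc(2) s P(2) by (intro add_mono mult_left_mono mult_right_mono) auto
  also have "\<dots> \<le> 3000 * sqrt k * s * P"
    using s P(2) by simp
  finally show ?thesis .
qed

section \<open>The first zero of the Bessel function\<close>

lemma summable_bessel0: "summable (\<lambda>m. (-1) ^ m / (fact m * fact m) * t ^ m :: real)"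
proof (rule summable_comparison_test')
  show "summable (\<lambda>m. inverse (fact m) * \<bar>t\<bar> ^ m)"
    by (rule summable_exp)
  show "norm ((-1) ^ m / (fact m * fact m) * t ^ m) \<le> inverse (fact m) * \<bar>t\<bar> ^ m" for m
  proof -
    have "inverse (fact m * fact m :: real) \<le> inverse (fact m)"
      by (intro le_imp_inverse_le) (auto simp: fact_ge_1)
    from mult_right_mono[OF this, of "\<bar>t\<bar> ^ m"] show ?thesis
      by (simp add: abs_mult power_abs divide_inverse)
  qed
qed

lemma bessel_J_0: "bessel_J 0 x = (\<Sum>m. (-1) ^ m / (fact m * fact m) * ((x / 2)\<^sup>2) ^ m)"
  by (simp add: bessel_J_def power_mult)

lemma continuous_bessel_J_0: "continuous_on UNIV (bessel_J 0)"
proof -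
  have "isCont (\<lambda>t::real. \<Sum>m. (-1) ^ m / (fact m * fact m) * t ^ m) t" for t
    by (rule isCont_powser_converges_everywhere) (rule summable_bessel0)
  then have c: "continuous_on UNIV (\<lambda>t::real. \<Sum>m. (-1) ^ m / (fact m * fact m) * t ^ m)"
    by (simp add: continuous_at_imp_continuous_on)
  have "continuous_on UNIV (\<lambda>x::real. \<Sum>m. (-1) ^ m / (fact m * fact m) * ((x / 2)\<^sup>2) ^ m)"
    by (rule continuous_on_compose2[OF c]) (auto intro!: continuous_intros)
  then show ?thesis
    unfolding bessel_J_0[abs_def] .
qed

text \<open>The leading term of the series is 1. With t = (x/2)^2 \<le> 1/4 the rest is dominated by
  the geometric sum t / (1 - t) < 1.\<close>

lemma bessel_J_0_pos:
  assumes "0 \<le> x" "x \<le> 1"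
  shows "0 < bessel_J 0 x"
proof -
  define t where "t = (x / 2)\<^sup>2"
  have t: "0 \<le> t" "t \<le> 1 / 4"
    using power_le_one[OF assms, of 2] by (simp_all add: t_def power_divide)
  define a where "a m = (-1) ^ m / (fact m * fact m) * t ^ m" for m
  have sa: "summable a"
    unfolding a_def by (rule summable_bessel0)
  have g: "(\<lambda>m. t ^ Suc m) sums (t / (1 - t))"
  proof -
    have "norm t < 1"
      using t by simp
    from sums_mult[OF geometric_sums[OF this], of t] show ?thesis
      by simp
  qed
  have "norm (a (Suc m)) \<le> t ^ Suc m" for m
  proof -
    have "1 / (fact (Suc m) * fact (Suc m) :: real) \<le> 1"
      using mult_mono[OF fact_ge_1[of "Suc m", where ?'a = real] fact_ge_1[of "Suc m"]] by simp
    from mult_right_mono[OF this, of "t ^ Suc m"] t show ?thesis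
      by (simp add: a_def abs_mult power_abs del: fact_Suc)
  qed
  then have "norm (\<Sum>m. a (Suc m)) \<le> (\<Sum>m. t ^ Suc m)"
    by (intro norm_suminf_le sums_summable[OF g])
      (auto)
  also have "\<dots> = t / (1 - t)"
    using g by (simp add: sums_iff)
  also have "\<dots> < 1"
    using t by simp
  finally have "\<bar>\<Sum>m. a (Suc m)\<bar> < 1" by simp
  moreover have "(\<Sum>m. a m) = a 0 + (\<Sum>m. a (Suc m))"
    using suminf_split_head[OF sa] by simp
  moreover have "a 0 = 1" by (simp add: a_def)
  moreover have "bessel_J 0 x = (\<Sum>m. a m)"
    by (simp only: bessel_J_0 a_def t_def)
  ultimately show ?thesis
    by linarith
qed

lemma two_power_le_fact: "4 \<le> m \<Longrightarrow> 2 ^ m \<le> (fact m :: real)"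
proof (induction m rule: dec_induct)
  case base
  then show ?case by (simp add: fact_numeral)
next
  case (step m)
  have "2 * 2 ^ m \<le> real (Suc m) * fact m"
    using step by (intro mult_mono) auto
  then show ?case by simp
qed

text \<open>At this point (x/2)^2 = 2, and the first four terms are 1 - 2 + 1 - 2/9. From m = 4 on,
  2^m \<le> m! bounds the tail by the sum of the 2^(-m), which is 1/8 < 2/9.\<close>

lemma bessel_J_0_neg: "bessel_J 0 (2 * sqrt 2) < 0"
proof -
  define a :: "nat \<Rightarrow> real" where "a m = (-1) ^ m / (fact m * fact m) * 2 ^ m" for m
  have sa: "summable a"
    unfolding a_def by (rule summable_bessel0)
  have g: "(\<lambda>m. (1/2) ^ (m + 4) :: real) sums (1 / 8)"
    using sums_mult2[OF geometric_sums[of "1/2 :: real"], of "(1/2)^4"]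
    by (simp add: power_add divide_simps power4_eq_xxxx)
  have "norm (a (m + 4)) \<le> (1/2) ^ (m + 4)" for m
  proof -
    have "(2 ^ (m + 4) * 2 ^ (m + 4) :: real) \<le> fact (m + 4) * fact (m + 4)"
      by (intro mult_mono two_power_le_fact) auto
    then have "2 ^ (m + 4) / (fact (m + 4) * fact (m + 4)) \<le> (1 / 2 ^ (m + 4) :: real)"
      by (simp add: divide_simps del: power_add)
    then show ?thesis
      by (simp add: a_def abs_mult power_abs power_one_over)
  qed
  then have "norm (\<Sum>m. a (m + 4)) \<le> (\<Sum>m. (1/2) ^ (m + 4))"
    by (intro norm_suminf_le sums_summable[OF g]) auto
  also have "\<dots> = 1 / 8"
    using g by (simp add: sums_iff)
  finally have "\<bar>\<Sum>m. a (m + 4)\<bar> \<le> 1 / 8" by simp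
  moreover have "(\<Sum>m. a m) = (\<Sum>m. a (m + 4)) + (\<Sum>m<4. a m)"
    using suminf_split_initial_segment[OF sa, of 4] by simp
  moreover have "(\<Sum>m<4. a m) = - 2 / 9"
    by (simp add: a_def eval_nat_numeral)
  ultimately have "(\<Sum>m. a m) < 0" by simp
  then show ?thesis
    by (simp add: bessel_J_0 a_def)
qed

lemma j01_ge_1: "1 \<le> j01"
proof -
  \<comment> \<open>\<open>LEAST\<close> over the reals is meaningful only if the minimum is
    attained. The sign change makes \<open>Z\<close> nonempty, compactness gives a least element,
    and zeros beyond \<open>2 * sqrt 2\<close> are larger anyway.\<close>
  define Z where "Z = {x \<in> {1..2 * sqrt 2}. bessel_J 0 x = 0}"
  have r2: "1 \<le> 2 * sqrt 2"
    using real_sqrt_ge_one[of 2] by linarith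
  have "\<exists>x. 1 \<le> x \<and> x \<le> 2 * sqrt 2 \<and> bessel_J 0 x = 0"
    using bessel_J_0_pos[of 1] bessel_J_0_neg r2
    by (intro IVT2' continuous_on_subset[OF continuous_bessel_J_0]) auto
  then have "Z \<noteq> {}"
    by (auto simp: Z_def)
  moreover have "compact Z"
  proof -
    have "closedin (top_of_set {1..2 * sqrt 2}) ({1..2 * sqrt 2} \<inter> bessel_J 0 -` {0})"
      by (intro continuous_closedin_preimage continuous_on_subset[OF continuous_bessel_J_0]) auto
    moreover have "{1..2 * sqrt 2} \<inter> bessel_J 0 -` {0} = Z"
      by (auto simp: Z_def)
    ultimately show ?thesis
      using closedin_compact[OF compact_Icc] by simp
  qed
  ultimately obtain z where z: "z \<in> Z" "\<And>x. x \<in> Z \<Longrightarrow> z \<le> x"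
    using compact_attains_inf[of Z] by metis
  have "j01 = z"
    unfolding j01_def
  proof (rule Least_equality)
    show "0 < z \<and> bessel_J 0 z = 0"
      using z by (auto simp: Z_def)
    fix y assume y: "0 < y \<and> bessel_J 0 y = 0"
    then have "1 \<le> y"
      using bessel_J_0_pos[of y] by force
    then show "z \<le> y"
      using z(1) z(2)[of y] y by (cases "y \<le> 2 * sqrt 2") (auto simp: Z_def)
  qed
  then show ?thesis
    using z by (auto simp: Z_def)
qed

section \<open>The size of \<open>Theta11\<close>\<close>

lemma Theta11_le: "Theta11 \<le> 1 / 10 ^ 13"
proof -
  have "sqrt 2 < 2"
    by (simp add: real_less_lsqrt)
  then have "0 \<le> 4 * pi / (1 - sqrt 2 / 2) * (1 / mu11_disk)"
    using mu11_disk_nonneg by simp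
  \<comment> \<open>Only \<open>0 \<le> mu11_disk\<close> enters: the second summand is nonnegative,
    and \<open>pi\<close> alone exceeds 1. The remaining factors 4 * 6^7 * 2^7 * 2^10 exceed
    10^11.\<close>
  then have "1 \<le> pi + 4 * pi / (1 - sqrt 2 / 2) * (1 / mu11_disk)"
    using pi_gt3 by linarith
  then have "inverse (pi + 4 * pi / (1 - sqrt 2 / 2) * (1 / mu11_disk)) \<le> 1"
    by (rule inverse_le_1_iff[THEN iffD2, OF disjI2])
  from mult_left_mono[OF this, of "1 / (4 * 6 ^ 7 * 2 ^ 7) * (1 / 2) ^ 10"]
  have "const_C \<le> 1 / (4 * 6 ^ 7 * 2 ^ 7) * (1 / 2) ^ 10"
    unfolding const_C_def by simp
  also have "\<dots> \<le> 1 / 10 ^ 11"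
    by (simp add: field_simps)
  finally show ?thesis
    unfolding Theta11_def by simp
qed

section \<open>The reverse Cheeger inequality\<close>

lemma cball_subset_cell:
  assumes "0 < s"
  shows "cball (\<chi> i. s * (of_int (c $ i) + 1 / 2)) (s / 2) \<subseteq> cell s c"
proof
  fix x :: "real^'a"
  let ?a = "\<chi> i. s * (of_int (c $ i) + 1 / 2)"
  assume "x \<in> cball ?a (s / 2)"
  then have "\<bar>?a $ i - x $ i\<bar> \<le> s / 2" for i
    using dist_vec_nth_le[of ?a i x] by (simp add: dist_real_def)
  then have "\<bar>s * of_int (c $ i) + s / 2 - x $ i\<bar> \<le> s / 2" for i
    by (simp add: distrib_left)
  then show "x \<in> cell s c"
    unfolding mem_cell by (smt (verit) field_sum_of_halves)
qed

text \<open>The infimum need not be attained, so the bound is taken at elements below h + e and e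
  tends to 0.\<close>

lemma le_mult_Inf_squared:
  fixes x :: ennreal
  assumes "0 < K" "\<And>q. q \<in> A \<Longrightarrow> x \<le> ennreal K * q\<^sup>2"
  shows "x \<le> ennreal K * (Inf A)\<^sup>2"
proof (cases "Inf A")
  case (real h)
  have le: "x \<le> ennreal (K * (h + e)\<^sup>2)" if "0 < e" for e
  proof -
    have "Inf A < ennreal (h + e)"
      using real that by (simp add: ennreal_less_iff)
    then obtain q where q: "q \<in> A" "q < ennreal (h + e)"
      by (auto simp: Inf_less_iff)
    have "x \<le> ennreal K * q\<^sup>2"
      using assms(2) q(1) .
    also have "\<dots> \<le> ennreal K * (ennreal (h + e))\<^sup>2"
      using q(2) by (intro mult_left_mono power_mono) auto
    also have "\<dots> = ennreal (K * (h + e)\<^sup>2)"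
      using assms(1) real that by (simp add: ennreal_power ennreal_mult del: ennreal_plus)
    finally show ?thesis .
  qed
  then obtain y where y: "x = ennreal y" "0 \<le> y"
    using le[of 1] by (cases x) (auto simp: top_unique)
  have "((\<lambda>e. K * (h + e)\<^sup>2) \<longlongrightarrow> K * (h + 0)\<^sup>2) (at_right 0)"
    by (intro tendsto_intros)
  moreover have "\<forall>\<^sub>F e in at_right 0. y \<le> K * (h + e)\<^sup>2"
    using le y assms(1) by (auto simp: eventually_at_filter)
  ultimately have "y \<le> K * (h + 0)\<^sup>2"
    by (rule tendsto_lowerbound) simp
  then show ?thesis
    using real assms(1) y by (simp add: ennreal_power ennreal_mult[symmetric] ennreal_leI)
next
  \<comment> \<open>This covers the empty \<open>A\<close>: the right-hand side is infinite because
    \<open>K\<close> is positive.\<close>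
  case top
  then show ?thesis
    unfolding top using assms(1) by (simp add: ennreal_mult_top)
qed

lemma freq_le_ratio:
  fixes E \<Omega> :: "(real^2) set"
  assumes mc: "multiply_connected k \<Omega>" "k \<noteq> 0"
    and E: "E \<noteq> {}" "open E" "bounded E" "E \<subseteq> \<Omega>"
  shows "freq \<Omega> \<le> ennreal (10 ^ 26 * real k) * (H1 (frontier E) / emeasure lebesgue E)\<^sup>2"
proof -
  define m where "m = measure lborel E"
  have "emeasure lborel E < \<infinity>"
    using E(3) by (rule emeasure_bounded_finite)
  then have em: "emeasure lborel E = ennreal m"
    by (simp add: m_def emeasure_eq_ennreal_measure)
  then have eml: "emeasure lebesgue E = ennreal m"
    using E(2) by simp
  have "\<not> negligible E"
    using E(1,2) open_not_negligible by blast
  then have "ennreal m \<noteq> 0"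
    using E(2) by (simp add: negligible_iff_null_sets null_sets_def flip: eml)
  then have m: "0 < m"
    by (simp add: ennreal_eq_0_iff)
  show ?thesis
  proof (cases "H1 (frontier E)")
    case (real P)
    \<comment> \<open>Positive area forces positive perimeter, so that \<open>s\<close> below is
      well defined.\<close>
    have "ennreal m \<le> (ennreal P)\<^sup>2"
      using isoperimetric_crude[OF E(3)] real em by simp
    then have "P \<noteq> 0"
      using m by auto
    with real have P: "0 < P"
      by simp
    \<comment> \<open>half of the value allowed by \<open>measure_le_perimeter\<close>, so that some cell lies in \<open>\<Omega>\<close>\<close>
    define s where "s = m / (6000 * sqrt k * P)"
    have s: "0 < s"
      using m P mc(2) by (simp add: s_def)
    have "\<exists>c. cell s c \<subseteq> \<Omega>"
    proof (rule ccontr)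
      assume "\<not> ?thesis"
      then have "m \<le> 3000 * sqrt k * s * P"
        unfolding m_def using real P by (intro measure_le_perimeter[OF mc E(2-4) s]) auto
      also have "\<dots> = m / 2"
        using P mc(2) by (simp add: s_def field_simps)
      finally show False
        using m by simp
    qed
    then obtain c where "cell s c \<subseteq> \<Omega>" ..
    with cball_subset_cell[OF s, of c] have "cball (\<chi> i. s * (of_int (c $ i) + 1 / 2)) (s / 2) \<subseteq> \<Omega>"
      by (rule order_trans)
    then have "freq \<Omega> \<le> ennreal (1296 * 2 ^ DIM(real^2) / (s / 2)\<^sup>2)"
      using mc(1) s by (intro freq_le_if_cball_subset) (auto simp: multiply_connected_def)
    \<comment> \<open>20736 = 1296 * 4 * 4: the dimension gives one factor 4, the radius
      \<open>s / 2\<close> the other.\<close>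
    also have "1296 * 2 ^ DIM(real^2) / (s / 2)\<^sup>2 = 20736 * (6000\<^sup>2 * k * (P / m)\<^sup>2)"
      using m P mc(2) by (simp add: s_def power_divide power_mult_distrib)
    also have "\<dots> \<le> 10 ^ 26 * real k * (P / m)\<^sup>2"
      using mult_right_mono[of "20736 * 6000\<^sup>2" "10 ^ 26" "k * (P / m)\<^sup>2"] by (simp add: mult_ac)
    finally have "freq \<Omega> \<le> ennreal (10 ^ 26 * real k * (P / m)\<^sup>2)"
      by (simp add: ennreal_leI)
    also have "\<dots> = ennreal (10 ^ 26 * real k) * (H1 (frontier E) / emeasure lebesgue E)\<^sup>2"
      using real P m by (simp add: eml divide_ennreal ennreal_power ennreal_mult)
    finally show ?thesis .
  next
    case top
    then show ?thesis
      using m mc(2) by (simp add: eml ennreal_top_divide ennreal_mult_top)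
  qed
qed

theorem theorem5p4:
  fixes k :: nat and \<Omega> :: "(real^2) set"
  assumes "k \<noteq> 0" and "open \<Omega>" and "multiply_connected k \<Omega>"
  shows "freq \<Omega> \<le> ennreal ((j01 / Theta11)\<^sup>2) * of_nat k * (cheeger \<Omega>)\<^sup>2"
proof -
  \<comment> \<open>The square of this ratio dominates the constant \<open>10 ^ 26\<close> of
    \<open>freq_le_ratio\<close>.\<close>
  have "10 ^ 13 \<le> j01 / Theta11"
  proof -
    have "10 ^ 13 * Theta11 \<le> j01"
      using Theta11_le j01_ge_1 by simp
    then show ?thesis
      using Theta11_pos by (simp add: pos_le_divide_eq)
  qed
  then have "(10 ^ 13)\<^sup>2 \<le> (j01 / Theta11)\<^sup>2"
    by (intro power_mono) auto
  then have K: "10 ^ 26 \<le> (j01 / Theta11)\<^sup>2"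
    by simp
  have "freq \<Omega> \<le> ennreal (10 ^ 26 * real k) * (cheeger \<Omega>)\<^sup>2"
    unfolding cheeger_def
  proof (rule le_mult_Inf_squared)
    show "0 < 10 ^ 26 * real k"
      using assms(1) by simp
    fix q assume "q \<in> (\<lambda>E. H1 (frontier E) / emeasure lebesgue E) `
      {E. E \<noteq> {} \<and> open E \<and> compact (closure E) \<and> closure E \<subseteq> \<Omega> \<and> smooth_boundary E}"
    then obtain E where E: "E \<noteq> {}" "open E" "compact (closure E)" "closure E \<subseteq> \<Omega>"
      and q: "q = H1 (frontier E) / emeasure lebesgue E"
      by blast
    have "bounded E"
      using bounded_subset[OF compact_imp_bounded[OF E(3)] closure_subset] .
    moreover have "E \<subseteq> \<Omega>"
      using closure_subset E(4) by (rule order_trans)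
    ultimately    show "freq \<Omega> \<le> ennreal (10 ^ 26 * real k) * q\<^sup>2"
      unfolding q using E(1,2) assms(1,3) by (intro freq_le_ratio)
  qed
  also have "\<dots> \<le> ennreal ((j01 / Theta11)\<^sup>2 * k) * (cheeger \<Omega>)\<^sup>2"
    using K by (intro mult_right_mono ennreal_leI) auto
  also have "ennreal ((j01 / Theta11)\<^sup>2 * k) = ennreal ((j01 / Theta11)\<^sup>2) * of_nat k"
    by (simp add: ennreal_mult ennreal_of_nat_eq_real_of_nat)
  finally show ?thesis .
qed

end
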